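(* Let $\Gamma$ be a subgroup of $\mathrm{PC}^{+}(\mathbf{S})$ including $\mathrm{IET}^{+}$. Then $\Gamma$ has, up to conjugation by a (unique) finitely supported permutation, only the two lifts $\Gamma_{\mathrm{left}}$ and $\Gamma_{\mathrm{right}}$. That is, for every lift $\tilde\Gamma$ of $\Gamma$ there is a unique finitely supported permutation $\sigma$ of $\mathbf{S}$ such that $\sigma\tilde\Gamma\sigma^{-1}$ is equal to $\Gamma_{\mathrm{left}}$ or $\Gamma_{\mathrm{right}}$.
   Context: Let $\mathbf{S}=\mathbf{R}/\mathbf{Z}$. Let $\widehat{\mathrm{PC}^{\bowtie}}(\mathbf{S})$ be the group of permutations of $\mathbf{S}$ that are continuous outside a finite subset, and $\mathrm{PC}^{\bowtie}(\mathbf{S})$ its quotient by the normal subgroup of finitely supported permutations, with quotient homomorphism $\pi$. $\mathrm{PC}^{+}(\mathbf{S})$ is the subgroup of $\mathrm{PC}^{\bowtie}(\mathbf{S})$ of piecewise orientation-preserving elements, and $\mathrm{IET}^{+}$ its subgroup of piecewise translations. A lift of a subgroup $\Gamma\subset\mathrm{PC}^{\bowtie}(\mathbf{S})$ is a subgroup $\tilde\Gamma\subset\widehat{\mathrm{PC}^{\bowtie}}(\mathbf{S})$ such that $\pi$ restricts to a bijection $\tilde\Gamma\to\Gamma$. For $\Gamma\le\mathrm{PC}^{+}(\mathbf{S})$, $\Gamma_{\mathrm{left}}$ (resp. $\Gamma_{\mathrm{right}}$) is the group of left-continuous (resp. right-continuous) representatives of elements of $\Gamma$. *)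

theory Defs
  imports "HOL-Analysis.Analysis" "HOL-Algebra.Coset"
begin

section \<open>The circle \<open>S = R/Z\<close>\<close>

quotient_type circle = real / "\<lambda>x y. x - y \<in> \<int>"
proof (rule equivpI)
  show "reflp (\<lambda>x y. x - y \<in> (\<int> :: real set))"
    by (simp add: reflp_def)
  show "symp (\<lambda>x y. x - y \<in> (\<int> :: real set))"
    by (metis Ints_minus minus_diff_eq sympI)
  show "transp (\<lambda>x y. x - y \<in> (\<int> :: real set))"
  proof (rule transpI)
    fix x y z :: real
    assume "x - y \<in> \<int>" "y - z \<in> \<int>"
    then have "(x - y) + (y - z) \<in> \<int>" by (rule Ints_add)
    then show "x - z \<in> \<int>" by simp
  qed
qed

lift_definition circ :: "real \<Rightarrow> circle" is "\<lambda>x. x" .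

instantiation circle :: ab_group_add
begin

lift_definition zero_circle :: circle is 0 .

lift_definition plus_circle :: "circle \<Rightarrow> circle \<Rightarrow> circle" is "(+)"
proof -
  fix x x' y y' :: real
  assume "x - x' \<in> \<int>" "y - y' \<in> \<int>"
  then have "(x - x') + (y - y') \<in> \<int>" by (rule Ints_add)
  then show "x + y - (x' + y') \<in> \<int>" by (simp add: algebra_simps)
qed

lift_definition uminus_circle :: "circle \<Rightarrow> circle" is uminus
  by (drule Ints_minus) (simp add: algebra_simps)

lift_definition minus_circle :: "circle \<Rightarrow> circle \<Rightarrow> circle" is "(-)"
proof -
  fix x x' y y' :: real
  assume "x - x' \<in> \<int>" "y - y' \<in> \<int>"
  then have "(x - x') - (y - y') \<in> \<int>" by (rule Ints_diff)
  then show "x - y - (x' - y') \<in> \<int>" by (simp add: algebra_simps)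
qed

instance
  by standard (transfer, simp)+

end

lemma circ_eq_iff: "circ x = circ y \<longleftrightarrow> x - y \<in> \<int>"
  by transfer simp

lemma circ_surj: "\<exists>t. x = circ t"
  by transfer (metis Ints_0 diff_self)

instantiation circle :: topological_space
begin

text \<open>The quotient topology.\<close>

definition open_circle :: "circle set \<Rightarrow> bool"
  where "open_circle U \<longleftrightarrow> open (circ -` U)"

instance
  by standard (auto simp: open_circle_def vimage_Union)

end

lemma open_circ_image:
  assumes "open A"
  shows "open (circ ` A)"
proof -
  have "circ -` (circ ` A) = (\<Union>n. (+) (of_int n) ` A)"
  proof (intro equalityI subsetI)
    fix x assume "x \<in> circ -` (circ ` A)"
    then obtain a where a: "a \<in> A" "x - a \<in> \<int>"
      by (auto simp: circ_eq_iff)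
    then obtain n where "x - a = of_int n" by (auto elim: Ints_cases)
    then have "x = of_int n + a" by simp
    with a show "x \<in> (\<Union>n. (+) (of_int n) ` A)" by blast
  next
    fix x assume "x \<in> (\<Union>n. (+) (of_int n) ` A)"
    then obtain n a where "a \<in> A" "x = of_int n + a" by blast
    then have "circ x = circ a" by (simp add: circ_eq_iff)
    with \<open>a \<in> A\<close> show "x \<in> circ -` (circ ` A)" by auto
  qed
  with assms show ?thesis
    unfolding open_circle_def by (simp add: open_translation open_UN)
qed

instance circle :: t2_space
proof
  fix x y :: circle
  assume "x \<noteq> y"
  obtain a b where ab: "x = circ a" "y = circ b"
    using circ_surj by metis
  define c where "c = frac (a - b)"
  have "a - b \<notin> \<int>" using \<open>x \<noteq> y\<close> ab by (simp add: circ_eq_iff)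
  then have c: "0 < c" "c < 1"
    by (simp_all add: c_def frac_gt_0_iff frac_lt_1)
  define d where "d = min c (1 - c) / 2"
  have d: "0 < d" using c by (simp add: d_def)
  have "circ ` ball a d \<inter> circ ` ball b d = {}"
  proof (rule ccontr)
    assume "circ ` ball a d \<inter> circ ` ball b d \<noteq> {}"
    then obtain u v where uv: "u \<in> ball a d" "v \<in> ball b d" "circ u = circ v"
      by blast
    then obtain n where n: "u - v = of_int n"
      by (auto simp: circ_eq_iff elim: Ints_cases)
    define m where "m = n - \<lfloor>a - b\<rfloor>"
    have m: "of_int m = (u - v) - (a - b) + c"
      by (simp add: m_def c_def frac_def n)
    have "\<bar>(u - v) - (a - b)\<bar> < 2 * d"
      using uv(1,2) by (auto simp: dist_real_def)
    then have "0 < real_of_int m" "real_of_int m < 1"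
      unfolding m d_def by (auto simp: min_def split: if_splits)
    then have "0 < m" "m < 1" by (simp_all only: of_int_0_less_iff of_int_less_1_iff)
    then show False by simp
  qed
  moreover have "x \<in> circ ` ball a d" "y \<in> circ ` ball b d"
    using d ab by auto
  ultimately show "\<exists>U V. open U \<and> open V \<and> x \<in> U \<and> y \<in> V \<and> U \<inter> V = {}"
    using open_circ_image open_ball by metis
qed


section \<open>Piecewise continuous permutations\<close>

definition PC_hat :: "(circle \<Rightarrow> circle) monoid"
  where "PC_hat = \<lparr>carrier = {f. bij f \<and> finite {x. \<not> isCont f x}},
                   mult = (\<circ>), one = id\<rparr>"

definition fin_supp :: "(circle \<Rightarrow> circle) set"
  where "fin_supp = {f. bij f \<and> finite {x. f x \<noteq> x}}"

definition PC :: "(circle \<Rightarrow> circle) set monoid"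
  where "PC = PC_hat Mod fin_supp"

definition pc_proj :: "(circle \<Rightarrow> circle) \<Rightarrow> (circle \<Rightarrow> circle) set"
  where "pc_proj f = fin_supp #>\<^bsub>PC_hat\<^esub> f"

text \<open>
  In the next two definitions the intervals \<open>{a<..<b}\<close> range over all parametrizations of
  open arcs that avoid the exceptional finite set \<open>F\<close>. If \<open>F\<close> is empty, \<open>b - a\<close> may exceed 1.
\<close>

definition piecewise_orientation_preserving :: "(circle \<Rightarrow> circle) \<Rightarrow> bool"
  where "piecewise_orientation_preserving f \<longleftrightarrow>
    (\<exists>F. finite F \<and>
      (\<forall>a b. circ ` {a<..<b} \<inter> F = {} \<longrightarrow>
        (\<exists>g :: real \<Rightarrow> real. continuous_on {a<..<b} g \<and> strict_mono_on {a<..<b} g \<and>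
          (\<forall>t\<in>{a<..<b}. f (circ t) = circ (g t)))))"

definition piecewise_translation :: "(circle \<Rightarrow> circle) \<Rightarrow> bool"
  where "piecewise_translation f \<longleftrightarrow>
    (\<exists>F. finite F \<and>
      (\<forall>a b. circ ` {a<..<b} \<inter> F = {} \<longrightarrow>
        (\<exists>c. \<forall>x\<in>circ ` {a<..<b}. f x = x + c)))"

text \<open>
  Both properties are insensitive to modifying \<open>f\<close> at finitely many points, so a class has the
  property as soon as one of its representatives has it.
\<close>

definition PC_plus :: "(circle \<Rightarrow> circle) set set"
  where "PC_plus = pc_proj ` {f \<in> carrier PC_hat. piecewise_orientation_preserving f}"

definition IET_plus :: "(circle \<Rightarrow> circle) set set"
  where "IET_plus = pc_proj ` {f \<in> carrier PC_hat. piecewise_translation f}"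


section \<open>Lifts\<close>

definition is_lift :: "(circle \<Rightarrow> circle) set set \<Rightarrow> (circle \<Rightarrow> circle) set \<Rightarrow> bool"
  where "is_lift \<Gamma> H \<longleftrightarrow> subgroup H PC_hat \<and> bij_betw pc_proj H \<Gamma>"

definition left_continuous :: "(circle \<Rightarrow> circle) \<Rightarrow> bool"
  where "left_continuous f \<longleftrightarrow> (\<forall>t. continuous (at_left t) (\<lambda>s. f (circ s)))"

definition right_continuous :: "(circle \<Rightarrow> circle) \<Rightarrow> bool"
  where "right_continuous f \<longleftrightarrow> (\<forall>t. continuous (at_right t) (\<lambda>s. f (circ s)))"

definition left_reps :: "(circle \<Rightarrow> circle) set set \<Rightarrow> (circle \<Rightarrow> circle) set"
  where "left_reps \<Gamma> = {f \<in> carrier PC_hat. pc_proj f \<in> \<Gamma> \<and> left_continuous f}"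

definition right_reps :: "(circle \<Rightarrow> circle) set set \<Rightarrow> (circle \<Rightarrow> circle) set"
  where "right_reps \<Gamma> = {f \<in> carrier PC_hat. pc_proj f \<in> \<Gamma> \<and> right_continuous f}"

definition conj_by :: "(circle \<Rightarrow> circle) \<Rightarrow> (circle \<Rightarrow> circle) set \<Rightarrow> (circle \<Rightarrow> circle) set"
  where "conj_by \<sigma> H = (\<lambda>f. \<sigma> \<otimes>\<^bsub>PC_hat\<^esub> f \<otimes>\<^bsub>PC_hat\<^esub> inv\<^bsub>PC_hat\<^esub> \<sigma>) ` H"

end

theory Submission imports Defs
begin

text \<open>
  Given a lift \<open>H\<close>, write \<open>\<rho>(a)\<close> for the lift of the rotation by \<open>a\<close>. The map \<open>a \<mapsto> \<rho>(- a)(a)\<close> is,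
  for each fixed \<open>b\<close>, invariant under \<open>a \<mapsto> a + b\<close> up to finitely many \<open>a\<close>; since the circle is
  uncountable, it is constant off a finite set. Its generic value \<open>p\<close> gives the finitely supported
  permutation \<open>a \<mapsto> \<rho>(a)(p)\<close>, which conjugates the lifted rotations to true rotations.

  Once \<open>H\<close> contains the rotations, exchanges of two small arcs have lifts in \<open>H\<close> with prescribed
  value at a given point. Commuting with these forces an element of \<open>H\<close> that is the identity on a
  punctured neighbourhood of \<open>x\<close> to fix \<open>x\<close>, and conjugating by them forces \<open>f x\<close> to be one of
  the two one-sided limits of \<open>f\<close> at \<open>x\<close>, the side being the same for all \<open>f\<close> and \<open>x\<close>. For
  uniqueness, two normalizing permutations differ by one that commutes with all rotations.
\<close>

unbundle no m_inv_syntax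

section \<open>Topology of the circle through the covering \<open>circ\<close>\<close>

lemma circ_0: "circ 0 = 0"
  by transfer simp

lemma circ_add: "circ (a + b) = circ a + circ b"
  by transfer simp

lemma continuous_circ: "continuous_on UNIV circ"
  by (simp add: continuous_on_open_vimage open_circle_def)

lemma isCont_add_circle: "isCont (\<lambda>x. x + (c::circle)) x"
proof -
  obtain d where d: "c = circ d" using circ_surj by blast
  have "open ((\<lambda>x. x + c) -` U)" if "open U" for U
  proof -
    have "circ -` ((\<lambda>x. x + c) -` U) = (\<lambda>t. t + d) -` (circ -` U)"
      by (auto simp: d circ_add)
    moreover have "open ((\<lambda>t::real. t + d) -` (circ -` U))"
      using that unfolding open_circle_def by (rule open_vimage) (intro continuous_intros)
    ultimately show ?thesis by (simp add: open_circle_def)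
  qed
  then have "continuous_on UNIV (\<lambda>x. x + c)"
    by (simp add: continuous_on_open_vimage)
  then show ?thesis by (simp add: continuous_on_eq_continuous_at)
qed

lemma inj_on_circ:
  assumes "\<And>s t. s \<in> A \<Longrightarrow> t \<in> A \<Longrightarrow> \<bar>s - t\<bar> < 1"
  shows "inj_on circ A"
proof (rule inj_onI)
  fix s t assume st: "s \<in> A" "t \<in> A" "circ s = circ t"
  then obtain n where n: "s - t = of_int n"
    by (auto simp: circ_eq_iff elim: Ints_cases)
  then have "\<bar>real_of_int n\<bar> < 1" using assms[OF st(1,2)] by simp
  then have "\<bar>n\<bar> < 1" by linarith
  then show "s = t" using n by simp
qed

lemma uncountable_circle: "uncountable (UNIV :: circle set)"
proof
  assume c: "countable (UNIV :: circle set)"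
  have "inj_on circ {0..<1}" by (rule inj_on_circ) auto
  moreover have "countable (circ ` {0..<1})" by (rule countable_subset[OF subset_UNIV c])
  ultimately have "countable {0..<1::real}" by (rule countable_image_inj_on[rotated])
  then show False using uncountable_half_open_interval_1[of 0 1] by simp
qed

text \<open>\<open>circ\<close> is continuous, open, and injective on open intervals of length 1, so
  punctured neighbourhoods correspond in both directions. Limits on the circle can thus be computed
  on the real line.\<close>

lemma filtermap_circ_at: "filtermap circ (at t) = at (circ t)"
proof (rule filter_eqI, rule iffI)
  fix P assume "eventually P (filtermap circ (at t))"
  then obtain T where T: "open T" "t \<in> T" "\<And>s. s \<in> T \<Longrightarrow> s \<noteq> t \<Longrightarrow> P (circ s)"
    by (auto simp: eventually_filtermap eventually_at_topological)
  have "open (circ ` T)" "circ t \<in> circ ` T" using T open_circ_image by auto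
  moreover have "P y" if "y \<in> circ ` T" "y \<noteq> circ t" for y
    using that T(3) by auto
  ultimately show "eventually P (at (circ t))"
    unfolding eventually_at_topological by blast
next
  fix P assume "eventually P (at (circ t))"
  then obtain U where U: "open U" "circ t \<in> U" "\<And>y. y \<in> U \<Longrightarrow> y \<noteq> circ t \<Longrightarrow> P y"
    by (auto simp: eventually_at_topological)
  have ne: "circ s \<noteq> circ t" if "s \<in> ball t (1/2)" "s \<noteq> t" for s
  proof -
    have "inj_on circ (ball t (1/2))"
      by (rule inj_on_circ) (simp add: dist_real_def abs_if split: if_splits)
    then show ?thesis using that by (auto dest: inj_onD)
  qed
  show "eventually P (filtermap circ (at t))"
    unfolding eventually_filtermap eventually_at_topological
    by (rule exI[of _ "circ -` U \<inter> ball t (1/2)"])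
       (use U ne in \<open>auto simp: open_circle_def\<close>)
qed

lemma at_circle_neq_bot: "at (x::circle) \<noteq> bot"
proof -
  obtain t where "x = circ t" using circ_surj by blast
  then show ?thesis
    by (metis filtermap_circ_at filtermap_bot_iff at_neq_bot)
qed

lemma eventually_at_not_in_finite:
  "finite F \<Longrightarrow> eventually (\<lambda>y. y \<notin> F) (at (x::'a::t1_space))"
  unfolding eventually_at_topological
  by (rule exI[of _ "- (F - {x})"]) (simp only: open_Compl finite_imp_closed finite_Diff, simp)


lemma filtermap_eventually_cong:
  assumes "eventually (\<lambda>x. f x = g x) F"
  shows "filtermap f F = filtermap g F"
proof (rule filter_eqI)
  fix P
  have "eventually (\<lambda>y. P (f y) \<longleftrightarrow> P (g y)) F"
    using assms by (rule eventually_mono) simp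
  then show "eventually P (filtermap f F) \<longleftrightarrow> eventually P (filtermap g F)"
    unfolding eventually_filtermap by (rule eventually_subst)
qed


section \<open>One-sided germs\<close>

text \<open>For \<open>G\<close> equal to \<open>at_left 0\<close> or \<open>at_right 0\<close> this
  is the filter of punctured one-sided neighbourhoods of \<open>x\<close>. Translating a filter at 0
  avoids choosing a real representative of \<open>x\<close>.\<close>

definition germ :: "real filter \<Rightarrow> circle \<Rightarrow> circle filter"
  where "germ G x = filtermap (\<lambda>s. x + circ s) G"

lemma filtermap_add_at_left: "filtermap (\<lambda>x. d + x) (at_left a) = at_left (d + a)" for a d :: real
  using filtermap_at_left_shift[of "-d" a] by (simp add: add.commute)

lemma filtermap_add_at_right: "filtermap (\<lambda>x. d + x) (at_right a) = at_right (d + a)" for a d :: real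
  using filtermap_at_right_shift[of "-d" a] by (simp add: add.commute)

lemma germ_left_circ: "germ (at_left 0) (circ t) = filtermap circ (at_left t)"
proof -
  have "germ (at_left 0) (circ t) = filtermap circ (filtermap (\<lambda>s. t + s) (at_left 0))"
    by (simp add: germ_def filtermap_filtermap circ_add)
  then show ?thesis by (simp add: filtermap_add_at_left)
qed

lemma germ_right_circ: "germ (at_right 0) (circ t) = filtermap circ (at_right t)"
proof -
  have "germ (at_right 0) (circ t) = filtermap circ (filtermap (\<lambda>s. t + s) (at_right 0))"
    by (simp add: germ_def filtermap_filtermap circ_add)
  then show ?thesis by (simp add: filtermap_add_at_right)
qed

lemma at_eq_sup_germs: "at x = sup (germ (at_left 0) x) (germ (at_right 0) x)"
proof -
  obtain t where t: "x = circ t" using circ_surj by blast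
  have "at x = filtermap circ (sup (at_left t) (at_right t))"
    by (simp add: t filtermap_circ_at flip: at_eq_sup_left_right)
  then show ?thesis by (simp add: t germ_left_circ germ_right_circ filtermap_sup)
qed

lemma filtermap_rotate_germ: "filtermap (\<lambda>x. x + c) (germ G x) = germ G (x + c)"
  by (simp add: germ_def filtermap_filtermap add_ac)

definition side :: "real filter \<Rightarrow> bool"
  where "side G \<longleftrightarrow> G = at_left 0 \<or> G = at_right 0"

lemma side_left: "side (at_left 0)" and side_right: "side (at_right 0)"
  by (simp_all add: side_def)

lemma germ_neq_bot: "side G \<Longrightarrow> germ G x \<noteq> bot"
  using trivial_limit_at_left_real[of 0] trivial_limit_at_right_real[of 0]
  unfolding side_def germ_def filtermap_bot_iff by metis

lemma germ_le_at: "side G \<Longrightarrow> germ G x \<le> at x"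
  by (auto simp: side_def at_eq_sup_germs)

lemma germ_le_nhds: "side G \<Longrightarrow> germ G x \<le> nhds x"
  using germ_le_at[of G x] by (simp add: at_within_def le_infI1 order_trans)

lemma germ_eq_iff: 
  assumes "side G" shows "germ G x = germ G y \<longleftrightarrow> x = y"
proof
  assume e: "germ G x = germ G y"
  have "filterlim id (nhds x) (germ G x)" "filterlim id (nhds y) (germ G x)"
    using germ_le_nhds[OF assms] by (auto simp: filterlim_def e) (metis e)
  then show "x = y" using tendsto_unique germ_neq_bot[OF assms] by metis
qed simp

lemma eventually_germ_not_in_finite: "side G \<Longrightarrow> finite F \<Longrightarrow> eventually (\<lambda>y. y \<notin> F) (germ G x)"
  using eventually_at_not_in_finite germ_le_at le_filter_def by metis

lemma filtermap_germ_cong: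
  assumes "side G" "finite {x. f x \<noteq> g x}"
  shows "filtermap f (germ G x) = filtermap g (germ G x)"
  using eventually_germ_not_in_finite[OF assms] by (intro filtermap_eventually_cong) simp

lemma germ_limit_unique:
  assumes "side G" "filtermap f (germ G x) = germ G y" "(f \<longlongrightarrow> z) (germ G x)"
  shows "z = y"
proof -
  have "(f \<longlongrightarrow> y) (germ G x)"
    using germ_le_nhds assms by (simp add: filterlim_def)
  then show ?thesis using tendsto_unique germ_neq_bot assms by metis
qed

section \<open>One-sided germs under orientation-preserving maps\<close>

text \<open>The limit is the supremum of \<open>g\<close>. Strictness keeps the values below it, and
  the intermediate value theorem makes them fill a left neighbourhood, so the filters are equal and
  not merely comparable.\<close>

lemma filtermap_strict_mono_at_left:
  fixes g :: "real \<Rightarrow> real"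
  assumes ab: "a < b" and cont: "continuous_on {a<..<b} g" and mono: "strict_mono_on {a<..<b} g"
    and bdd: "bdd_above (g ` {a<..<b})"
  shows "\<exists>l. filtermap g (at_left b) = at_left l"
proof
  define l where "l = Sup (g ` {a<..<b})"
  have less: "g s < l" if "s \<in> {a<..<b}" for s
  proof -
    have "s < b" using that by simp
    then obtain s' where "s < s'" "s' < b" using dense by blast
    then have "g s < g s'" using that mono by (auto simp: strict_mono_on_def)
    also have "g s' \<le> l" unfolding l_def using \<open>s < s'\<close> \<open>s' < b\<close> that by (intro cSUP_upper bdd) auto
    finally show ?thesis .
  qed
  have above: "\<exists>s\<in>{c<..<b}. y < g s" if yc: "y < l" "c < b" for y c
  proof -
    have "{a<..<b} \<noteq> {}" using ab by simp
    then obtain s where s: "s \<in> {a<..<b}" "y < g s"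
      using yc(1) less_cSUP_iff[OF _ bdd, of y] unfolding l_def by auto
    obtain s' where s': "max s c < s'" "s' < b" using s yc dense[of "max s c" b] by (metis greaterThanLessThan_iff max_less_iff_conj)
    then have "g s < g s'" using s mono by (auto simp: strict_mono_on_def)
    then show ?thesis using s s' by (intro bexI[of _ s']) auto
  qed
  show "filtermap g (at_left b) = at_left l"
  proof (rule filter_eqI, rule iffI)
    fix P assume "eventually P (filtermap g (at_left b))"
    then obtain c where c: "c < b" "\<And>s. c < s \<Longrightarrow> s < b \<Longrightarrow> P (g s)"
      by (auto simp: eventually_filtermap eventually_at_left_field)
    obtain s where s: "max a c < s" "s < b" using ab c(1) dense[of "max a c" b] by (metis max_less_iff_conj)
    have "P y" if y: "g s < y" "y < l" for y
    proof -
      obtain s' where s': "s' \<in> {s<..<b}" "y < g s'" using above y s by blast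
      have "continuous_on {s..s'} g" using s s' by (intro continuous_on_subset[OF cont]) auto
      then obtain u where "s \<le> u" "u \<le> s'" "g u = y" using IVT'[of g s y s'] y s' by auto
      then show ?thesis using c(2)[of u] s s' by auto
    qed
    then show "eventually P (at_left l)"
      using less[of s] s unfolding eventually_at_left_field by auto
  next
    fix P assume "eventually P (at_left l)"
    then obtain c where c: "c < l" "\<And>y. c < y \<Longrightarrow> y < l \<Longrightarrow> P y"
      by (auto simp: eventually_at_left_field)
    then obtain s where s: "s \<in> {a<..<b}" "c < g s" using above ab by blast
    have "P (g u)" if "s < u" "u < b" for u
    proof -
      have "g s < g u" using that s mono by (auto simp: strict_mono_on_def)
      then show ?thesis using that s c less[of u] by auto
    qed
    then show "eventually P (filtermap g (at_left b))"
      using s unfolding eventually_filtermap eventually_at_left_field by auto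
  qed
qed

lemma filtermap_strict_mono_at_right:
  fixes g :: "real \<Rightarrow> real"
  assumes ab: "a < b" and cont: "continuous_on {a<..<b} g" and mono: "strict_mono_on {a<..<b} g"
    and bdd: "bdd_below (g ` {a<..<b})"
  shows "\<exists>l. filtermap g (at_right a) = at_right l"
proof -
  define h where "h s = - g (- s)" for s
  have "continuous_on {-b<..<-a} h"
    unfolding h_def by (intro continuous_intros continuous_on_compose2[OF cont]) auto
  moreover have "strict_mono_on {-b<..<-a} h"
    using mono by (auto simp: strict_mono_on_def h_def)
  moreover have "bdd_above (h ` {-b<..<-a})"
  proof -
    obtain m where "\<And>x. x \<in> {a<..<b} \<Longrightarrow> m \<le> g x" using bdd unfolding bdd_below_def by blast
    then show ?thesis by (auto simp: bdd_above_def h_def intro!: exI[of _ "-m"])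
  qed
  ultimately obtain l where l: "filtermap h (at_left (-a)) = at_left l"
    using filtermap_strict_mono_at_left[of "-b" "-a" h] ab by auto
  have "filtermap g (at_right a) = filtermap uminus (filtermap h (at_left (-a)))"
    by (simp add: at_right_minus[of a] filtermap_filtermap h_def)
  also have "\<dots> = at_right (-l)" by (simp add: l at_right_minus[of "-l"])
  finally show ?thesis ..
qed

text \<open>If the lift rose by 1, it would hit \<open>g s' + 1\<close> at a second point, where
  \<open>f\<close> repeats its value at \<open>circ s'\<close>. The bound guarantees one-sided
  limits at the ends of an arc.\<close>

lemma lift_osc_less_1:
  fixes g :: "real \<Rightarrow> real"
  assumes "inj f" "b - a < 1" and cont: "continuous_on {a<..<b} g" and mono: "strict_mono_on {a<..<b} g"
    and lift: "\<And>t. t \<in> {a<..<b} \<Longrightarrow> f (circ t) = circ (g t)"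
    and s: "s \<in> {a<..<b}" and s': "s' \<in> {a<..<b}"
  shows "g s < g s' + 1"
proof (rule ccontr)
  assume neg: "\<not> g s < g s' + 1"
  have "s' < s"
  proof (rule ccontr)
    assume "\<not> s' < s"
    then have "g s \<le> g s'"
      using mono s s' by (cases "s = s'") (auto simp: strict_mono_on_def less_imp_le)
    then show False using neg by simp
  qed
  have "continuous_on {s'..s} g" using s s' by (intro continuous_on_subset[OF cont]) auto
  then obtain u where u: "s' \<le> u" "u \<le> s" "g u = g s' + 1"
    using IVT'[of g s' "g s' + 1" s] neg \<open>s' < s\<close> by auto
  have "f (circ u) = f (circ s')"
    using lift[of u] lift[OF s'] u s s' by (simp add: circ_eq_iff)
  then have "circ u = circ s'" using \<open>inj f\<close> by (simp add: inj_eq)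
  moreover have "inj_on circ {a<..<b}" using \<open>b - a < 1\<close> by (intro inj_on_circ) auto
  ultimately have "u = s'" using u s s' by (auto dest: inj_onD)
  then show False using u by simp
qed

text \<open>On a short arc on one side of \<open>x\<close>, \<open>f\<close> lifts to a strictly
  increasing bounded real function, which preserves the side of approach.\<close>

lemma filtermap_germ_orientation_preserving:
  assumes f: "bij f" "piecewise_orientation_preserving f" and G: "side G"
  shows "\<exists>y. filtermap f (germ G x) = germ G y"
proof -
  obtain F where F: "finite F" and
    lift: "\<And>a b. circ ` {a<..<b} \<inter> F = {} \<Longrightarrow>
        \<exists>g :: real \<Rightarrow> real. continuous_on {a<..<b} g \<and> strict_mono_on {a<..<b} g \<and>
          (\<forall>t\<in>{a<..<b}. f (circ t) = circ (g t))"
    using f(2) unfolding piecewise_orientation_preserving_def by blast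
  obtain t where t: "x = circ t" using circ_surj by blast
  have "eventually (\<lambda>s. circ s \<notin> F) (at t)"
    using eventually_at_not_in_finite[OF F, of "circ t"]
    by (simp add: eventually_filtermap flip: filtermap_circ_at)
  then obtain d where d: "d > 0" "\<And>s. s \<noteq> t \<Longrightarrow> dist s t < d \<Longrightarrow> circ s \<notin> F"
    unfolding eventually_at by auto
  \<comment> \<open>The cap 1/2 makes the one-sided arcs shorter than 1, as
    \<open>lift_osc_less_1\<close> requires.\<close>
  define e where "e = min d (1/2)"
  have e: "0 < e" "e < 1" using d by (auto simp: e_def)
  have ev: "filtermap f (filtermap circ H) = filtermap circ (filtermap g H)"
    if "eventually (\<lambda>s. s \<in> {a<..<b}) H" "\<forall>t\<in>{a<..<b}. f (circ t) = circ (g t)" for a b g H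
    unfolding filtermap_filtermap using that(2)
    by (intro filtermap_eventually_cong eventually_mono[OF that(1)]) auto
  from G show ?thesis unfolding side_def
  proof
    assume G: "G = at_left 0"
    have "circ ` {t - e<..<t} \<inter> F = {}" using d(2) by (auto simp: e_def dist_real_def)
    from lift[OF this] obtain g where g: "continuous_on {t - e<..<t} g" "strict_mono_on {t - e<..<t} g"
      "\<forall>s\<in>{t - e<..<t}. f (circ s) = circ (g s)" by blast
    have "t - e / 2 \<in> {t - e<..<t}" using e by auto
    then have "bdd_above (g ` {t - e<..<t})"
      using lift_osc_less_1[OF bij_is_inj[OF f(1)] _ g(1,2)] g(3) e
      by (intro bdd_aboveI[of _ "g (t - e/2) + 1"]) (auto intro: less_imp_le)
    then obtain l where l: "filtermap g (at_left t) = at_left l"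
      using filtermap_strict_mono_at_left[OF _ g(1,2)] e by auto
    have "eventually (\<lambda>s. s \<in> {t - e<..<t}) (at_left t)"
      using e by (auto simp: eventually_at_left_field intro!: exI[of _ "t - e"])
    from ev[OF this g(3)] show ?thesis
      by (intro exI[of _ "circ l"]) (simp add: G t germ_left_circ l)
  next
    assume G: "G = at_right 0"
    have "circ ` {t<..<t + e} \<inter> F = {}" using d(2) by (auto simp: e_def dist_real_def)
    from lift[OF this] obtain g where g: "continuous_on {t<..<t + e} g" "strict_mono_on {t<..<t + e} g"
      "\<forall>s\<in>{t<..<t + e}. f (circ s) = circ (g s)" by blast
    have m: "t + e / 2 \<in> {t<..<t + e}" using e by auto
    have "g (t + e/2) - 1 \<le> g s" if "s \<in> {t<..<t + e}" for s
      using lift_osc_less_1[OF bij_is_inj[OF f(1)] _ g(1,2) _ m that] g(3) e by auto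
    then have "bdd_below (g ` {t<..<t + e})"
      by (intro bdd_belowI[of _ "g (t + e/2) - 1"]) auto
    then obtain l where l: "filtermap g (at_right t) = at_right l"
      using filtermap_strict_mono_at_right[OF _ g(1,2)] e by auto
    have "eventually (\<lambda>s. s \<in> {t<..<t + e}) (at_right t)"
      using e by (auto simp: eventually_at_right_field intro!: exI[of _ "t + e"])
    from ev[OF this g(3)] show ?thesis
      by (intro exI[of _ "circ l"]) (simp add: G t germ_right_circ l)
  qed
qed

section \<open>Continuity of inverses on the circle\<close>

lemma isCont_circ_iff: "isCont f (circ t) \<longleftrightarrow> isCont (f \<circ> circ) t"
  unfolding isCont_def comp_def by (subst filtermap_circ_at[symmetric]) (simp add: filterlim_filtermap)

text \<open>The local inverse is continuous because \<open>circ\<close> is open and injective on the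
  ball; it turns circle-valued maps into real-valued ones.\<close>

lemma continuous_section_circ:
  "continuous_on (circ ` ball c (1/2)) (inv_into (ball c (1/2)) circ)"
proof (rule continuous_on_inverse_open_map)
  show "continuous_on (ball c (1/2)) circ" using continuous_circ continuous_on_subset by blast
  show "inv_into (ball c (1/2)) circ (circ x) = x" if "x \<in> ball c (1/2)" for x
    using that by (intro inv_into_f_f inj_on_circ) (auto simp: dist_real_def abs_if split: if_splits)
  fix U assume "openin (top_of_set (ball c (1/2))) U"
  then have "open U" "U \<subseteq> ball c (1/2)" by (auto simp: openin_open_eq)
  then show "openin (top_of_set (circ ` ball c (1/2))) (circ ` U)"
    by (intro open_subset open_circ_image) auto
qed simp

text \<open>One-dimensional invariance of domain, transported through local lifts to the real line.\<close>

lemma isCont_inv_circle: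
  fixes f :: "circle \<Rightarrow> circle"
  assumes "bij f" "open U" "x \<in> U" and cont: "\<And>z. z \<in> U \<Longrightarrow> isCont f z"
  shows "isCont (inv f) (f x)"
proof -
  obtain t c where t: "x = circ t" and c: "f x = circ c" using circ_surj by metis
  define B where "B = ball c (1/2)"
  define q where "q = inv_into B circ"
  have q: "circ (q y) = y" if "y \<in> circ ` B" for y
    using that by (simp add: q_def f_inv_into_f)
  define V where "V = circ -` (U \<inter> f -` (circ ` B))"
  have "open (U \<inter> f -` (circ ` B))"
    using assms by (intro continuous_open_preimage continuous_at_imp_continuous_on)
      (auto simp: B_def intro: open_circ_image)
  then have V: "open V" "t \<in> V"
    using \<open>x \<in> U\<close> by (auto simp: V_def open_circle_def t[symmetric] c B_def)
  then obtain d where d: "d > 0" "ball t d \<subseteq> V" by (auto simp: open_contains_ball)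
  define D where "D = ball t (min d (1/2))"
  have D: "D \<subseteq> V" "t \<in> D" "open D" using d by (auto simp: D_def)
  have injD: "inj_on circ D"
    unfolding D_def by (rule inj_on_circ) (auto simp: dist_real_def abs_if split: if_splits)
  \<comment> \<open>\<open>g\<close> is \<open>f\<close> in local real coordinates around
    \<open>x\<close> and \<open>f x\<close>; it will be continuous and injective on
    \<open>D\<close>, hence open.\<close>
  define g where "g s = q (f (circ s))" for s
  have g: "circ (g s) = f (circ s)" if "s \<in> D" for s
    using that D by (auto simp: g_def V_def intro: q)
  have "continuous_on D (\<lambda>s. f (circ s))"
  proof (rule continuous_at_imp_continuous_on, rule ballI)
    fix s assume "s \<in> D"
    then have "isCont f (circ s)" using D cont by (auto simp: V_def)
    then show "isCont (\<lambda>s. f (circ s)) s" by (simp add: isCont_circ_iff comp_def)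
  qed
  then have "continuous_on D g"
    unfolding g_def q_def B_def
    by (rule continuous_on_compose2[OF continuous_section_circ]) (use D in \<open>auto simp: V_def B_def\<close>)
  moreover have "inj_on g D"
  proof (rule inj_onI)
    fix s s' assume s: "s \<in> D" "s' \<in> D" "g s = g s'"
    then have "f (circ s) = f (circ s')" using g by metis
    then have "circ s = circ s'" using \<open>bij f\<close> by (simp add: bij_is_inj inj_eq)
    then show "s = s'" using s inj_onD[OF injD] by blast
  qed
  ultimately have open_g: "open (g ` T)" if "open T" "T \<subseteq> D" for T
    using injective_into_1d_imp_open_map_UNIV that by blast
  show ?thesis unfolding continuous_at_open
  proof (intro allI impI)
    fix N assume N: "open N \<and> inv f (f x) \<in> N"
    define T where "T = D \<inter> circ -` N"
    have "x \<in> N" using N \<open>bij f\<close> by (simp add: bij_is_inj)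
    have T: "open T" "T \<subseteq> D" "t \<in> T"
      using N D \<open>x \<in> N\<close> t by (auto simp: T_def open_circle_def)
    have "f ` circ ` T = circ ` g ` T" using g T(2) by (force simp: image_iff)
    then have "open (f ` circ ` T)" using open_g[OF T(1,2)] open_circ_image by simp
    moreover have "f x \<in> f ` circ ` T" using T(3) t by auto
    moreover have "inv f y \<in> N" if "y \<in> f ` circ ` T" for y
      using that \<open>bij f\<close> by (auto simp: bij_is_inj T_def)
    ultimately show "\<exists>S. open S \<and> f x \<in> S \<and> (\<forall>x'\<in>S. inv f x' \<in> N)" by blast
  qed
qed

lemma isCont_cong_finite:
  fixes f g :: "'a::t2_space \<Rightarrow> 'b::topological_space"
  assumes "finite {x. f x \<noteq> g x}" "f x = g x" "isCont f x"
  shows "isCont g x"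
proof -
  have "open (- {x. f x \<noteq> g x})" using assms(1) by (simp add: open_Compl finite_imp_closed)
  then have "eventually (\<lambda>y. f y = g y) (nhds x)"
    unfolding eventually_nhds using assms(2) by blast
  then show ?thesis using assms(3) isCont_cong by blast
qed

lemma finite_discontinuities_cong:
  fixes f g :: "'a::t2_space \<Rightarrow> 'b::topological_space"
  assumes "finite {x. f x \<noteq> g x}" "finite {x. \<not> isCont f x}"
  shows "finite {x. \<not> isCont g x}"
proof (rule finite_subset)
  show "{x. \<not> isCont g x} \<subseteq> {x. f x \<noteq> g x} \<union> {x. \<not> isCont f x}"
    using isCont_cong_finite[OF assms(1)] by blast
qed (use assms in simp)


section \<open>The groups of piecewise continuous permutations\<close>

lemma carrier_PC_hat: "f \<in> carrier PC_hat \<longleftrightarrow> bij f \<and> finite {x. \<not> isCont f x}"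
  by (simp add: PC_hat_def)

lemma mult_PC_hat [simp]: "mult PC_hat f g = f \<circ> g"
  and one_PC_hat [simp]: "one PC_hat = id"
  by (simp_all add: PC_hat_def)

lemma bij_PC_hat: "f \<in> carrier PC_hat \<Longrightarrow> bij f"
  by (simp add: carrier_PC_hat)

lemma finite_vimage_bij: "bij f \<Longrightarrow> finite A \<Longrightarrow> finite {x. f x \<in> A}"
  using finite_vimageI[of A f] by (simp add: bij_is_inj vimage_def)

lemma comp_PC_hat:
  assumes "f \<in> carrier PC_hat" "g \<in> carrier PC_hat"
  shows "f \<circ> g \<in> carrier PC_hat"
proof -
  have "finite {x. g x \<in> {y. \<not> isCont f y}}"
    using assms by (intro finite_vimage_bij) (auto simp: carrier_PC_hat)
  moreover have "{x. \<not> isCont (f \<circ> g) x} \<subseteq> {x. \<not> isCont g x} \<union> {x. g x \<in> {y. \<not> isCont f y}}"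
    using continuous_at_compose by blast
  ultimately have "finite {x. \<not> isCont (f \<circ> g) x}"
    using assms finite_subset by (fastforce simp: carrier_PC_hat)
  then show ?thesis using assms by (simp add: carrier_PC_hat bij_comp)
qed

text \<open>The complement of the finite discontinuity set of \<open>f\<close> is open, so
  \<open>isCont_inv_circle\<close> applies at the image of every continuity point.\<close>

lemma inv_in_PC_hat:
  assumes "f \<in> carrier PC_hat"
  shows "inv f \<in> carrier PC_hat"
proof -
  have f: "bij f" "finite {x. \<not> isCont f x}" using assms by (auto simp: carrier_PC_hat)
  have "isCont (inv f) y" if "y \<notin> f ` {x. \<not> isCont f x}" for y
  proof -
    have y: "y = f (inv f y)" using f(1) by (simp add: bij_is_surj surj_f_inv_f)
    then have "inv f y \<in> - {x. \<not> isCont f x}" using that by auto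
    then have "isCont (inv f) (f (inv f y))"
      using f by (intro isCont_inv_circle[of f "- {x. \<not> isCont f x}"])
        (auto intro!: open_Compl finite_imp_closed simp del: Compl_eq)
    then show ?thesis using y by simp
  qed
  then have "{y. \<not> isCont (inv f) y} \<subseteq> f ` {x. \<not> isCont f x}" by blast
  then show ?thesis using f finite_subset by (fastforce simp: carrier_PC_hat bij_imp_bij_inv)
qed

lemma group_PC_hat: "group PC_hat"
proof (rule groupI)
  show "\<one>\<^bsub>PC_hat\<^esub> \<in> carrier PC_hat" by (simp add: carrier_PC_hat id_def[abs_def] bij_id[unfolded id_def])
  fix f assume f: "f \<in> carrier PC_hat"
  then show "\<exists>g\<in>carrier PC_hat. g \<otimes>\<^bsub>PC_hat\<^esub> f = \<one>\<^bsub>PC_hat\<^esub>"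
    using inv_in_PC_hat by (intro bexI[of _ "inv f"]) (auto simp: bij_PC_hat bij_is_inj)
qed (auto simp: comp_PC_hat comp_assoc)

interpretation PC_hat: group PC_hat by (rule group_PC_hat)

lemma inv_PC_hat [simp]:
  assumes "f \<in> carrier PC_hat"
  shows "m_inv PC_hat f = inv f"
  using assms inv_in_PC_hat by (intro PC_hat.inv_equality) (auto simp: bij_PC_hat bij_is_inj)

lemma PC_hat_cong_finite:
  assumes "finite {x. f x \<noteq> g x}" "f \<in> carrier PC_hat" "bij g"
  shows "g \<in> carrier PC_hat"
  using assms finite_discontinuities_cong by (auto simp: carrier_PC_hat)

lemma fin_supp_subset: "fin_supp \<subseteq> carrier PC_hat"
proof
  fix f assume "f \<in> fin_supp"
  then have "finite {x. id x \<noteq> f x}" "bij f"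
    by (simp_all add: fin_supp_def eq_commute)
  moreover have "id \<in> carrier PC_hat" using PC_hat.one_closed by simp
  ultimately show "f \<in> carrier PC_hat" using PC_hat_cong_finite by blast
qed

lemma finite_neq_comp:
  assumes "finite {x. f x \<noteq> f' x}" "finite {x. g x \<noteq> g' x}" "bij g"
  shows "finite {x. (f \<circ> g) x \<noteq> (f' \<circ> g') x}"
proof (rule finite_subset)
  show "{x. (f \<circ> g) x \<noteq> (f' \<circ> g') x} \<subseteq> {x. g x \<in> {x. f x \<noteq> f' x}} \<union> {x. g x \<noteq> g' x}"
    by auto
qed (use assms finite_vimage_bij[OF assms(3,1)] in simp)

lemma subgroup_fin_supp: "subgroup fin_supp PC_hat"
proof (rule PC_hat.subgroupI)
  show "fin_supp \<subseteq> carrier PC_hat" by (rule fin_supp_subset)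
  show "fin_supp \<noteq> {}" by (auto simp: fin_supp_def intro!: exI[of _ id])
  fix f assume f: "f \<in> fin_supp"
  have "{x. inv f x \<noteq> x} = {x. f x \<noteq> x}"
    using f by (auto simp: fin_supp_def bij_is_inj bij_is_surj surj_f_inv_f) (metis bij_inv_eq_iff)+
  then show "m_inv PC_hat f \<in> fin_supp"
    using f fin_supp_subset by (auto simp: fin_supp_def bij_imp_bij_inv subset_iff)
  fix g assume g: "g \<in> fin_supp"
  show "f \<otimes>\<^bsub>PC_hat\<^esub> g \<in> fin_supp"
    using f g finite_neq_comp[of f id g id] by (auto simp: fin_supp_def bij_comp)
qed

lemma normal_fin_supp: "fin_supp \<lhd> PC_hat"
proof -
  have "f \<circ> h \<circ> inv f \<in> fin_supp" if "f \<in> carrier PC_hat" "h \<in> fin_supp" for f h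
  proof -
    have f: "bij f" using that by (simp add: bij_PC_hat)
    have "finite {x. inv f x \<in> {x. h x \<noteq> x}}"
      using f that by (intro finite_vimage_bij) (auto simp: bij_imp_bij_inv fin_supp_def)
    moreover have "{x. (f \<circ> h \<circ> inv f) x \<noteq> x} \<subseteq> {x. inv f x \<in> {x. h x \<noteq> x}}"
      using f by (auto simp: bij_is_surj surj_f_inv_f)
    ultimately show ?thesis
      using f that by (auto simp: fin_supp_def bij_comp bij_imp_bij_inv intro: finite_subset)
  qed
  then show ?thesis
    unfolding PC_hat.normal_inv_iff using subgroup_fin_supp by auto
qed

interpretation fin_supp: normal fin_supp PC_hat by (rule normal_fin_supp)

text \<open>Finite disagreement is the convenient form of equivalence; the factor from
  \<open>fin_supp\<close> is recovered as \<open>g \<circ> inv f\<close>.\<close>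

lemma pc_proj_eq:
  assumes "f \<in> carrier PC_hat"
  shows "pc_proj f = {g. bij g \<and> finite {x. g x \<noteq> f x}}"
proof (intro equalityI subsetI)
  fix g assume "g \<in> pc_proj f"
  then obtain h where h: "h \<in> fin_supp" "g = h \<circ> f" by (auto simp: pc_proj_def r_coset_def)
  have f: "bij f" using assms by (rule bij_PC_hat)
  have "finite {y. h y \<noteq> y}" "bij h" using h(1) by (simp_all add: fin_supp_def)
  then have "finite {x. f x \<in> {y. h y \<noteq> y}}" "bij g"
    using finite_vimage_bij[OF f] bij_comp[OF f] h(2) by blast+
  then show "g \<in> {g. bij g \<and> finite {x. g x \<noteq> f x}}"
    by (simp add: h(2))
next
  fix g assume "g \<in> {g. bij g \<and> finite {x. g x \<noteq> f x}}"
  then have g: "bij g" "finite {x. g x \<noteq> f x}" by auto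
  have f: "bij f" using assms by (simp add: bij_PC_hat)
  have "finite {y. inv f y \<in> {x. g x \<noteq> f x}}"
    using f g by (intro finite_vimage_bij) (auto simp: bij_imp_bij_inv)
  moreover have "{y. (g \<circ> inv f) y \<noteq> y} = {y. inv f y \<in> {x. g x \<noteq> f x}}"
    using f by (simp add: bij_is_surj surj_f_inv_f)
  ultimately have "g \<circ> inv f \<in> fin_supp"
    using f g by (simp add: fin_supp_def bij_comp bij_imp_bij_inv)
  moreover have "g = (g \<circ> inv f) \<circ> f" using f by (simp add: comp_assoc bij_is_inj)
  ultimately show "g \<in> pc_proj f" by (auto simp: pc_proj_def r_coset_def)
qed

lemma finite_neq_sym: "finite {x. f x \<noteq> g x} \<Longrightarrow> finite {x. g x \<noteq> f x}"
  by (simp add: eq_commute)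

lemma finite_neq_trans:
  assumes "finite {x. f x \<noteq> g x}" "finite {x. g x \<noteq> h x}"
  shows "finite {x. f x \<noteq> h x}"
  by (rule finite_subset[of _ "{x. f x \<noteq> g x} \<union> {x. g x \<noteq> h x}"]) (use assms in auto)

lemma pc_proj_eq_iff:
  assumes "f \<in> carrier PC_hat" "g \<in> carrier PC_hat"
  shows "pc_proj f = pc_proj g \<longleftrightarrow> finite {x. f x \<noteq> g x}"
proof
  assume "pc_proj f = pc_proj g"
  moreover have "f \<in> pc_proj f" using assms by (simp add: pc_proj_eq bij_PC_hat)
  ultimately show "finite {x. f x \<noteq> g x}" using assms by (simp add: pc_proj_eq)
next
  assume fg: "finite {x. f x \<noteq> g x}"
  have "finite {x. h x \<noteq> f x} \<longleftrightarrow> finite {x. h x \<noteq> g x}" for h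
    using finite_neq_trans[OF _ fg] finite_neq_trans[OF _ finite_neq_sym[OF fg]] by blast
  then show "pc_proj f = pc_proj g" using assms by (simp add: pc_proj_eq)
qed

lemma pc_proj_hom: "group_hom PC_hat PC pc_proj"
proof (intro group_hom.intro group_hom_axioms.intro)
  show "group PC" unfolding PC_def by (rule fin_supp.factorgroup_is_group)
  show "pc_proj \<in> hom PC_hat PC"
    using fin_supp.r_coset_hom_Mod by (simp only: PC_def pc_proj_def[abs_def])
qed (rule group_PC_hat)

interpretation pc_proj: group_hom PC_hat PC pc_proj by (rule pc_proj_hom)


section \<open>Piecewise translations\<close>

lemma piecewise_translation_in_PC_hat:
  assumes "bij f" "piecewise_translation f"
  shows "f \<in> carrier PC_hat"
proof -
  obtain F where F: "finite F"
    "\<And>a b. circ ` {a<..<b} \<inter> F = {} \<Longrightarrow> \<exists>c. \<forall>x\<in>circ ` {a<..<b}. f x = x + c"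
    using assms(2) unfolding piecewise_translation_def by blast
  have "isCont f x" if "x \<notin> F" for x
  proof -
    obtain t where t: "x = circ t" using circ_surj by blast
    have "open (circ -` (- F))"
      using open_Compl[OF finite_imp_closed[OF F(1)]] by (simp only: open_circle_def)
    moreover have "t \<in> circ -` (- F)" using that t by simp
    ultimately obtain d where d: "d > 0" "ball t d \<subseteq> circ -` (- F)" by (rule openE)
    have ball: "ball t d = {t - d<..<t + d}" by (auto simp: dist_real_def)
    then have "circ ` {t - d<..<t + d} \<inter> F = {}" using d by auto
    then obtain c where c: "\<forall>x\<in>circ ` {t - d<..<t + d}. f x = x + c" using F(2) by blast
    have "eventually (\<lambda>y. f y = y + c) (nhds x)"
      unfolding eventually_nhds using c d(1) t open_circ_image
      by (intro exI[of _ "circ ` {t - d<..<t + d}"]) auto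
    then show ?thesis using isCont_add_circle isCont_cong by metis
  qed
  then have "{x. \<not> isCont f x} \<subseteq> F" by blast
  then show ?thesis using F(1) assms(1) finite_subset by (auto simp: carrier_PC_hat)
qed

lemma piecewise_translation_rotation: "piecewise_translation (\<lambda>x. x + c)"
  unfolding piecewise_translation_def by (intro exI[of _ "{}"]) auto

lemma bij_rotation: "bij (\<lambda>x. x + (c::circle))"
  by (rule o_bij[of "\<lambda>x. x - c"]) auto

text \<open>When \<open>A\<close> is disjoint from its translate by \<open>c\<close>, this is the
  involution exchanging the two sets.\<close>

definition swap :: "'a::ab_group_add set \<Rightarrow> 'a \<Rightarrow> 'a \<Rightarrow> 'a"
  where "swap A c x = (if x \<in> A then x + c else if x - c \<in> A then x - c else x)"

lemma bij_swap:
  assumes "\<And>x. x \<in> A \<Longrightarrow> x + c \<notin> A"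
  shows "bij (swap A c)"
proof -
  have "x - c \<notin> A" if "x \<in> A" for x using assms[of "x - c"] that by auto
  then have "swap A c (swap A c x) = x" for x
    using assms[of x] assms[of "x - c"] by (auto simp: swap_def)
  then show ?thesis by (intro o_bij[of "swap A c"] ext) simp_all
qed

lemma frontier_arc: "frontier (circ ` {a<..<b}) \<subseteq> {circ a, circ b}"
proof -
  have "compact (circ ` {a..b})"
    by (intro compact_continuous_image continuous_on_subset[OF continuous_circ]) auto
  then have "closed (circ ` {a..b})" by (rule compact_imp_closed)
  then have cl: "closure (circ ` {a<..<b}) \<subseteq> circ ` {a..b}" by (intro closure_minimal) auto
  have int: "interior (circ ` {a<..<b}) = circ ` {a<..<b}"
    by (simp add: interior_open open_circ_image)
  have "circ ` {a..b} \<subseteq> circ ` {a<..<b} \<union> {circ a, circ b}"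
  proof
    fix x assume "x \<in> circ ` {a..b}"
    then obtain s where "x = circ s" "s = a \<or> s = b \<or> s \<in> {a<..<b}" by force
    then show "x \<in> circ ` {a<..<b} \<union> {circ a, circ b}" by blast
  qed
  with cl have "closure (circ ` {a<..<b}) \<subseteq> circ ` {a<..<b} \<union> {circ a, circ b}"
    by (rule order_trans)
  then show ?thesis unfolding frontier_def int by blast
qed

text \<open>A connected set meeting both an arc and its complement meets the frontier of the arc,
  hence contains an endpoint.\<close>

lemma arc_subset_or_disjoint:
  assumes "circ ` {u<..<v} \<inter> {circ a, circ b} = {}"
  shows "circ ` {u<..<v} \<subseteq> circ ` {a<..<b} \<or> circ ` {u<..<v} \<inter> circ ` {a<..<b} = {}"
proof (rule ccontr)
  assume "\<not> ?thesis"
  moreover have "connected (circ ` {u<..<v})"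
    by (intro connected_continuous_image continuous_on_subset[OF continuous_circ]) auto
  ultimately have "circ ` {u<..<v} \<inter> frontier (circ ` {a<..<b}) \<noteq> {}"
    by (intro connected_Int_frontier) auto
  then show False using assms frontier_arc by blast
qed

lemma piecewise_translation_swap:
  "piecewise_translation (swap (circ ` {a<..<b}) c)"
  unfolding piecewise_translation_def
\<comment> \<open>The endpoints of the arc and of its translate suffice: an arc avoiding them lies
  wholly inside or wholly outside each of the two.\<close>
proof (intro exI[of _ "{circ a, circ b, circ a + c, circ b + c}"] conjI allI impI)
  obtain d where d: "c = circ d" using circ_surj by blast
  have shift: "x \<in> circ ` {a + d<..<b + d} \<longleftrightarrow> x - c \<in> circ ` {a<..<b}" for x
  proof
    assume "x \<in> circ ` {a + d<..<b + d}"
    then obtain s where s: "x = circ s" "a + d < s" "s < b + d" by auto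
    then have "x - c = circ (s - d)" using circ_add[of "s - d" d] by (simp add: d)
    then show "x - c \<in> circ ` {a<..<b}" using s by auto
  next
    assume "x - c \<in> circ ` {a<..<b}"
    then obtain s where s: "x - c = circ s" "a < s" "s < b" by auto
    then have "x = circ (s + d)" by (simp add: d circ_add algebra_simps)
    then show "x \<in> circ ` {a + d<..<b + d}" using s by auto
  qed
  fix u v assume uv: "circ ` {u<..<v} \<inter> {circ a, circ b, circ a + c, circ b + c} = {}"
  have "circ ` {u<..<v} \<inter> {circ a, circ b} = {}" 
    "circ ` {u<..<v} \<inter> {circ (a + d), circ (b + d)} = {}"
    using uv by (auto simp: d circ_add)
  note * = this[THEN arc_subset_or_disjoint]
  define A where "A = circ ` {a<..<b}"
  have **: "(\<forall>x\<in>circ ` {u<..<v}. x \<in> A) \<or> (\<forall>x\<in>circ ` {u<..<v}. x \<notin> A)"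
    "(\<forall>x\<in>circ ` {u<..<v}. x - c \<in> A) \<or> (\<forall>x\<in>circ ` {u<..<v}. x - c \<notin> A)"
    using * unfolding A_def shift[symmetric] by blast+
  consider "\<forall>x\<in>circ ` {u<..<v}. x \<in> A"
    | "\<forall>x\<in>circ ` {u<..<v}. x \<notin> A" "\<forall>x\<in>circ ` {u<..<v}. x - c \<in> A"
    | "\<forall>x\<in>circ ` {u<..<v}. x \<notin> A" "\<forall>x\<in>circ ` {u<..<v}. x - c \<notin> A"
    using ** by blast
  then have "\<exists>e. \<forall>x\<in>circ ` {u<..<v}. swap A c x = x + e"
  proof cases
    case 1 then show ?thesis by (intro exI[of _ c]) (simp add: swap_def)
  next
    case 2 then show ?thesis by (intro exI[of _ "- c"]) (simp add: swap_def)
  next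
    case 3 then show ?thesis by (intro exI[of _ 0]) (simp add: swap_def)
  qed
  then show "\<exists>e. \<forall>x\<in>circ ` {u<..<v}. swap (circ ` {a<..<b}) c x = x + e" by (simp add: A_def)
qed simp


section \<open>One-sided limits and one-sided representatives\<close>

locale iet_overgroup =
  fixes \<Gamma> :: "(circle \<Rightarrow> circle) set set"
  assumes subgroup_\<Gamma>: "subgroup \<Gamma> PC" and \<Gamma>_PC_plus: "\<Gamma> \<subseteq> PC_plus" and IET_\<Gamma>: "IET_plus \<subseteq> \<Gamma>"
begin

definition grp :: "(circle \<Rightarrow> circle) set"
  where "grp = {f \<in> carrier PC_hat. pc_proj f \<in> \<Gamma>}"

lemma grp_PC_hat: "f \<in> grp \<Longrightarrow> f \<in> carrier PC_hat"
  by (simp add: grp_def)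

lemma grp_bij: "f \<in> grp \<Longrightarrow> bij f"
  by (simp add: grp_PC_hat bij_PC_hat)

lemma grp_comp: "f \<in> grp \<Longrightarrow> g \<in> grp \<Longrightarrow> f \<circ> g \<in> grp"
  using pc_proj.hom_mult[of f g] subgroup.m_closed[OF subgroup_\<Gamma>]
  by (simp add: grp_def comp_PC_hat)

lemma grp_inv:
  assumes "f \<in> grp" shows "inv f \<in> grp"
proof -
  have f: "f \<in> carrier PC_hat" "pc_proj f \<in> \<Gamma>" using assms by (auto simp: grp_def)
  have "pc_proj (inv f) = m_inv PC (pc_proj f)" using pc_proj.hom_inv[of f] f by simp
  then show ?thesis
    using f subgroup.m_inv_closed[OF subgroup_\<Gamma>] by (simp add: grp_def inv_in_PC_hat)
qed

lemma grp_cong: "f \<in> grp \<Longrightarrow> finite {x. f x \<noteq> g x} \<Longrightarrow> bij g \<Longrightarrow> g \<in> grp"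
  using PC_hat_cong_finite[of f g] pc_proj_eq_iff[of f g] by (auto simp: grp_def)

lemma grp_translation: "bij f \<Longrightarrow> piecewise_translation f \<Longrightarrow> f \<in> grp"
  using IET_\<Gamma> piecewise_translation_in_PC_hat by (auto simp: grp_def IET_plus_def)

lemma grp_rotation: "(\<lambda>x. x + c) \<in> grp"
  by (intro grp_translation bij_rotation piecewise_translation_rotation)

lemma grp_id: "id \<in> grp"
  using grp_rotation[of 0] by (simp add: id_def)

text \<open>Equality of filters, rather than convergence, records that \<open>f\<close> approaches
  the limit from the same side, which lets one-sided limits be composed.\<close>

definition olim :: "real filter \<Rightarrow> (circle \<Rightarrow> circle) \<Rightarrow> circle \<Rightarrow> circle"
  where "olim G f x = (THE y. filtermap f (germ G x) = germ G y)"

lemma olim_eqI: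
  assumes "side G" "filtermap f (germ G x) = germ G y"
  shows "olim G f x = y"
  unfolding olim_def using assms germ_eq_iff by (intro the_equality) auto

text \<open>The class of \<open>f\<close> has a piecewise orientation-preserving representative, and
  germs do not see the finitely many points where the two differ.\<close>

lemma filtermap_germ:
  assumes G: "side G" and f: "f \<in> grp"
  shows "filtermap f (germ G x) = germ G (olim G f x)"
proof -
  have "pc_proj f \<in> PC_plus" using f \<Gamma>_PC_plus by (auto simp: grp_def)
  then obtain g where g: "g \<in> carrier PC_hat" "piecewise_orientation_preserving g"
    "pc_proj f = pc_proj g" by (auto simp: PC_plus_def)
  then have "finite {x. f x \<noteq> g x}" using f pc_proj_eq_iff by (simp add: grp_def)
  then have "filtermap f (germ G x) = filtermap g (germ G x)"
    by (rule filtermap_germ_cong[OF G])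
  moreover obtain y where "filtermap g (germ G x) = germ G y"
    using filtermap_germ_orientation_preserving[OF bij_PC_hat[OF g(1)] g(2) G] by blast
  ultimately show ?thesis using olim_eqI[OF G] by metis
qed

lemma olim_comp:
  assumes "side G" "f \<in> grp" "g \<in> grp"
  shows "olim G (f \<circ> g) x = olim G f (olim G g x)"
  using assms by (intro olim_eqI) (simp_all add: comp_def filtermap_germ flip: filtermap_filtermap)

lemma olim_eventually_rotation:
  assumes "side G" "eventually (\<lambda>y. f y = y + c) (germ G x)"
  shows "olim G f x = x + c"
  using assms filtermap_eventually_cong[OF assms(2)]
  by (intro olim_eqI) (simp_all add: filtermap_rotate_germ)

lemma olim_rotation: "side G \<Longrightarrow> olim G (\<lambda>x. x + c) x = x + c"
  by (intro olim_eventually_rotation) auto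

lemma olim_id: "side G \<Longrightarrow> olim G id x = x"
  using olim_rotation[of G 0 x] by (simp add: id_def)

lemma olim_cong: "side G \<Longrightarrow> finite {x. f x \<noteq> g x} \<Longrightarrow> olim G f x = olim G g x"
  by (simp add: olim_def filtermap_germ_cong[of G f g])

lemma olim_inv:
  assumes "side G" "f \<in> grp"
  shows "olim G (inv f) (olim G f x) = x" "olim G f (olim G (inv f) x) = x"
proof -
  have "inv f \<circ> f = id" "f \<circ> inv f = id"
    using grp_bij[OF assms(2)] by (simp_all add: bij_is_inj bij_is_surj flip: surj_iff)
  then show "olim G (inv f) (olim G f x) = x" "olim G f (olim G (inv f) x) = x"
    using assms grp_inv[of f] by (simp_all add: olim_id flip: olim_comp)
qed

lemma tendsto_germ_iff:
  assumes "side G" "f \<in> grp"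
  shows "(f \<longlongrightarrow> z) (germ G x) \<longleftrightarrow> olim G f x = z"
proof
  assume "(f \<longlongrightarrow> z) (germ G x)"
  then show "olim G f x = z" using assms germ_limit_unique filtermap_germ by metis
next
  assume "olim G f x = z"
  then show "(f \<longlongrightarrow> z) (germ G x)"
    using assms filtermap_germ[of G f x] germ_le_nhds by (simp add: filterlim_def)
qed

text \<open>At a point of continuity the one-sided limit is the value.\<close>

lemma finite_olim_neq:
  assumes "side G" "f \<in> grp"
  shows "finite {x. f x \<noteq> olim G f x}"
proof (rule finite_subset)
  show "{x. f x \<noteq> olim G f x} \<subseteq> {x. \<not> isCont f x}"
  proof safe
    fix x assume "isCont f x" "f x \<noteq> olim G f x"
    moreover from this have "(f \<longlongrightarrow> f x) (germ G x)"
      using germ_le_at[OF assms(1)] by (auto simp: isCont_def intro: filterlim_mono)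
    ultimately show False using tendsto_germ_iff[OF assms] by metis
  qed
  show "finite {x. \<not> isCont f x}" using assms by (simp add: grp_def carrier_PC_hat)
qed

text \<open>Bijectivity holds because \<open>olim G (inv f)\<close> is a two-sided inverse.\<close>

lemma olim_grp:
  assumes "side G" "f \<in> grp"
  shows "olim G f \<in> grp"
proof (rule grp_cong[OF assms(2) finite_olim_neq[OF assms]])
  show "bij (olim G f)"
    by (rule o_bij[of "olim G (inv f)"]) (use olim_inv[OF assms] in auto)
qed

definition reps :: "real filter \<Rightarrow> (circle \<Rightarrow> circle) set"
  where "reps G = {f \<in> grp. \<forall>x. olim G f x = f x}"

lemma left_reps_eq: "left_reps \<Gamma> = reps (at_left 0)"
proof -
  have "left_continuous f \<longleftrightarrow> (\<forall>x. (f \<longlongrightarrow> f x) (germ (at_left 0) x))" for f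
  proof -
    have "(\<forall>x. (f \<longlongrightarrow> f x) (germ (at_left 0) x)) \<longleftrightarrow>
        (\<forall>t. (f \<longlongrightarrow> f (circ t)) (germ (at_left 0) (circ t)))"
      by (metis circ_surj)
    then show ?thesis
      by (simp add: left_continuous_def continuous_within germ_left_circ filterlim_filtermap)
  qed
  then show ?thesis
    using tendsto_germ_iff[OF side_left] by (auto simp: left_reps_def reps_def grp_def)
qed

lemma right_reps_eq: "right_reps \<Gamma> = reps (at_right 0)"
proof -
  have "right_continuous f \<longleftrightarrow> (\<forall>x. (f \<longlongrightarrow> f x) (germ (at_right 0) x))" for f
  proof -
    have "(\<forall>x. (f \<longlongrightarrow> f x) (germ (at_right 0) x)) \<longleftrightarrow>
        (\<forall>t. (f \<longlongrightarrow> f (circ t)) (germ (at_right 0) (circ t)))"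
      by (metis circ_surj)
    then show ?thesis
      by (simp add: right_continuous_def continuous_within germ_right_circ filterlim_filtermap)
  qed
  then show ?thesis
    using tendsto_germ_iff[OF side_right] by (auto simp: right_reps_def reps_def grp_def)
qed

text \<open>\<open>olim G f\<close> differs from \<open>f\<close> at finitely many points, so it has
  the same one-sided limits.\<close>

lemma olim_reps:
  assumes "side G" "f \<in> grp" shows "olim G f \<in> reps G"
proof -
  have "olim G (olim G f) x = olim G f x" for x
    using olim_cong[OF assms(1) finite_olim_neq[OF assms]] by (rule sym)
  then show ?thesis using olim_grp[OF assms] by (simp add: reps_def)
qed

text \<open>\<open>olim G\<close> supplies a representative in each class; since it ignores finite
  sets, two members of \<open>reps G\<close> in one class coincide.\<close>

lemma is_lift_reps:
  assumes G: "side G" shows "is_lift \<Gamma> (reps G)"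
  unfolding is_lift_def
proof
  show "subgroup (reps G) PC_hat"
  proof (rule PC_hat.subgroupI)
    show "reps G \<subseteq> carrier PC_hat" using grp_PC_hat by (auto simp: reps_def)
    show "reps G \<noteq> {}" using olim_reps[OF G grp_id] by blast
    fix f assume f: "f \<in> reps G"
    then have fg: "f \<in> grp" "olim G f = f" by (auto simp: reps_def)
    have "olim G (inv f) x = inv f x" for x
      using olim_inv(2)[OF G fg(1), of x] fg grp_bij[of f] by (metis bij_inv_eq_iff)
    then show "m_inv PC_hat f \<in> reps G"
      using fg grp_PC_hat grp_inv by (simp add: reps_def)
    fix g assume "g \<in> reps G"
    then show "f \<otimes>\<^bsub>PC_hat\<^esub> g \<in> reps G"
      using f grp_comp olim_comp[OF G] by (simp add: reps_def)
  qed
  show "bij_betw pc_proj (reps G) \<Gamma>"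
  proof (rule bij_betw_imageI)
    show "inj_on pc_proj (reps G)"
    proof (rule inj_onI)
      fix f g assume "f \<in> reps G" "g \<in> reps G" "pc_proj f = pc_proj g"
      moreover from this have "finite {x. f x \<noteq> g x}"
        using pc_proj_eq_iff grp_PC_hat by (simp add: reps_def)
      ultimately show "f = g" using olim_cong[OF G, of f g] by (simp add: reps_def fun_eq_iff)
    qed
    show "pc_proj ` reps G = \<Gamma>"
    proof (intro equalityI subsetI)
      fix \<gamma> assume "\<gamma> \<in> \<Gamma>"
      moreover from this obtain f where f: "f \<in> carrier PC_hat" "\<gamma> = pc_proj f"
        using \<Gamma>_PC_plus by (auto simp: PC_plus_def)
      ultimately have "f \<in> grp" by (simp add: grp_def)
      then have "olim G f \<in> reps G" "pc_proj (olim G f) = \<gamma>"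
        using olim_reps olim_grp grp_PC_hat pc_proj_eq_iff f finite_olim_neq G by metis+
      then show "\<gamma> \<in> pc_proj ` reps G" by blast
    qed (auto simp: reps_def grp_def)
  qed
qed

end

section \<open>Straightening the rotations\<close>

text \<open>Uncountability replaces the usual one-endedness hypothesis on the group.\<close>

lemma almost_invariant_imp_almost_constant:
  fixes h :: "'a::ab_group_add \<Rightarrow> 'b"
  assumes unc: "uncountable (UNIV :: 'a set)" and inv: "\<And>b. finite {a. h (a + b) \<noteq> h a}"
  shows "\<exists>k. finite {a. h a \<noteq> k}"
proof -
  have "infinite (UNIV :: 'a set)" using unc countable_finite by blast
  then obtain s :: "nat \<Rightarrow> 'a" where s: "inj s" using infinite_countable_subset by blast
  \<comment> \<open>For \<open>t\<close> outside the countable set \<open>C\<close>,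
    \<open>h\<close> has a single value along the whole sequence \<open>t + s n\<close>.\<close>
  define C where "C = (\<Union>n m. {t. h (t + s n) \<noteq> h (t + s m)})"
  have "finite {t. h (t + s n) \<noteq> h (t + s m)}" for n m
  proof -
    have "{t. h (t + s n) \<noteq> h (t + s m)} = (\<lambda>t. t + s m) -` {a. h (a + (s n - s m)) \<noteq> h a}"
      by (auto simp: algebra_simps)
    moreover have "finite ((\<lambda>t. t + s m) -` {a. h (a + (s n - s m)) \<noteq> h a})"
      by (intro finite_vimageI inv) (simp add: inj_def)
    ultimately show ?thesis by simp
  qed
  then have C: "countable C" unfolding C_def by (intro countable_UN[OF countableI_type] countable_finite)
  then obtain t0 where t0: "t0 \<notin> C" using unc by (metis UNIV_eq_I)
  define k where "k = h (t0 + s 0)"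
  define K where "K = {a. h a \<noteq> k}"
  have k: "h (t + s 0) = k" if "t \<notin> C" for t
  proof -
    \<comment> \<open>The shift by \<open>t - t0\<close> changes \<open>h\<close> at only finitely
      many of the infinitely many points \<open>t0 + s n\<close>, so some \<open>n\<close> links
      \<open>t\<close> to \<open>t0\<close>.\<close>
    have "\<not> range (\<lambda>n. t0 + s n) \<subseteq> {a. h (a + (t - t0)) \<noteq> h a}"
    proof
      assume "range (\<lambda>n. t0 + s n) \<subseteq> {a. h (a + (t - t0)) \<noteq> h a}"
      then have "finite (range (\<lambda>n. t0 + s n))" using inv finite_subset by blast
      moreover have "inj (\<lambda>n. t0 + s n)" using s by (simp add: inj_def)
      ultimately show False using finite_imageD infinite_UNIV_nat by blast
    qed
    then obtain n where n: "h (t0 + s n + (t - t0)) = h (t0 + s n)" by blast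
    then have "h (t + s n) = h (t0 + s n)" by (simp add: algebra_simps)
    moreover have "h (t + s 0) = h (t + s n)" "h (t0 + s 0) = h (t0 + s n)"
      using that t0 by (auto simp: C_def)
    ultimately show ?thesis by (simp add: k_def)
  qed
  have "K \<subseteq> (\<lambda>t. t + s 0) ` C"
  proof
    fix a assume "a \<in> K"
    then have "a - s 0 \<in> C" using k[of "a - s 0"] by (auto simp: K_def)
    then show "a \<in> (\<lambda>t. t + s 0) ` C" by (rule rev_image_eqI) simp
  qed
  then have "countable K" using C countable_subset countable_image by metis
  \<comment> \<open>Taking \<open>b\<close> outside all differences of elements of \<open>K\<close>
    moves \<open>K\<close> off itself, so \<open>K\<close> lies in the finite set where the shift by
    \<open>b\<close> changes \<open>h\<close>.\<close>
  then have "countable (\<Union>a\<in>K. (\<lambda>a'. a' - a) ` K)" by (intro countable_UN countable_image)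
  then obtain b where b: "b \<notin> (\<Union>a\<in>K. (\<lambda>a'. a' - a) ` K)" using unc by (metis UNIV_eq_I)
  have "K \<subseteq> {a. h (a + b) \<noteq> h a}"
  proof
    fix a assume a: "a \<in> K"
    have "a + b \<notin> K"
    proof
      assume "a + b \<in> K"
      then have "(a + b) - a \<in> (\<lambda>a'. a' - a) ` K" by (rule imageI)
      then show False using a b by auto
    qed
    then show "a \<in> {a. h (a + b) \<noteq> h a}" using a by (auto simp: K_def)
  qed
  then show ?thesis using inv finite_subset unfolding K_def by blast
qed

text \<open>An injection maps its set of moved points into itself, and onto itself when that set is
  finite; all other points are fixed.\<close>

lemma fin_supp_bijI:
  assumes "inj f" and fin: "finite {x. f x \<noteq> x}"
  shows "f \<in> fin_supp"
proof -
  let ?E = "{x. f x \<noteq> x}"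
  have "f ` ?E \<subseteq> ?E" using \<open>inj f\<close> by (auto simp: inj_eq)
  moreover have "inj_on f ?E" using \<open>inj f\<close> inj_on_subset by blast
  ultimately have "f ` ?E = ?E" by (rule endo_inj_surj[OF fin])
  have "y \<in> range f" for y
  proof (cases "f y = y")
    case True then show ?thesis by (metis rangeI)
  next
    case False
    then have "y \<in> f ` ?E" using \<open>f ` ?E = ?E\<close> by blast
    then show ?thesis by blast
  qed
  then show ?thesis using assms by (auto simp: fin_supp_def bij_def)
qed

section \<open>Conjugation of lifts by finitely supported permutations\<close>

lemma conj_by_fin_supp:
  "\<sigma> \<in> fin_supp \<Longrightarrow> conj_by \<sigma> H = (\<lambda>f. \<sigma> \<circ> f \<circ> inv \<sigma>) ` H"
  using fin_supp_subset by (auto simp: conj_by_def)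

lemma finite_neq_conj:
  assumes "\<sigma> \<in> fin_supp" "bij f"
  shows "finite {x. (\<sigma> \<circ> f \<circ> inv \<sigma>) x \<noteq> f x}"
proof -
  have \<sigma>: "bij \<sigma>" "finite {x. \<sigma> x \<noteq> id x}" using assms by (auto simp: fin_supp_def)
  have i: "finite {x. inv \<sigma> x \<noteq> id x}"
    using subgroup.m_inv_closed[OF subgroup_fin_supp assms(1)] fin_supp_subset assms(1)
    by (auto simp: fin_supp_def subset_iff)
  have "finite {x. (\<sigma> \<circ> (f \<circ> inv \<sigma>)) x \<noteq> (id \<circ> (f \<circ> id)) x}"
    using \<sigma> assms i by (intro finite_neq_comp bij_comp bij_imp_bij_inv) auto
  then show ?thesis by (simp add: comp_assoc)
qed

text \<open>Conjugation changes each element at finitely many points only, hence keeps its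
  class.\<close>

lemma (in iet_overgroup) is_lift_conj_by:
  assumes \<sigma>: "\<sigma> \<in> fin_supp" and H: "is_lift \<Gamma> H"
  shows "is_lift \<Gamma> (conj_by \<sigma> H)"
  unfolding is_lift_def conj_by_fin_supp[OF \<sigma>]
proof
  have sub: "subgroup H PC_hat" and bb: "bij_betw pc_proj H \<Gamma>" using H by (auto simp: is_lift_def)
  have Hc: "f \<in> carrier PC_hat" if "f \<in> H" for f using that sub subgroup.subset by blast
  have \<sigma>c: "\<sigma> \<in> carrier PC_hat" and b\<sigma>: "bij \<sigma>" using \<sigma> fin_supp_subset bij_PC_hat by blast+
  define \<phi> where "\<phi> f = \<sigma> \<circ> f \<circ> inv \<sigma>" for f
  have \<phi>c: "\<phi> f \<in> carrier PC_hat" if "f \<in> H" for f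
    using that Hc \<sigma>c by (simp add: \<phi>_def comp_PC_hat inv_in_PC_hat)
  have \<phi>_comp: "\<phi> f \<circ> \<phi> g = \<phi> (f \<circ> g)" for f g
    using b\<sigma> by (auto simp: \<phi>_def fun_eq_iff bij_is_inj)
  have one: "\<phi> id = id" using b\<sigma> by (auto simp: \<phi>_def fun_eq_iff bij_is_surj surj_f_inv_f)
  show "subgroup ((\<lambda>f. \<sigma> \<circ> f \<circ> inv \<sigma>) ` H) PC_hat"
    unfolding \<phi>_def[symmetric]
  proof (rule PC_hat.subgroupI)
    show "\<phi> ` H \<subseteq> carrier PC_hat" using \<phi>c by blast
    show "\<phi> ` H \<noteq> {}" using subgroup.one_closed[OF sub] by blast
    fix a assume "a \<in> \<phi> ` H"
    then obtain f where f: "f \<in> H" "a = \<phi> f" by blast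
    have "inv f \<in> H" using subgroup.m_inv_closed[OF sub f(1)] Hc[OF f(1)] by simp
    moreover have "m_inv PC_hat a = \<phi> (inv f)"
      using f \<phi>c[OF f(1)] \<phi>c[OF \<open>inv f \<in> H\<close>] bij_PC_hat[OF Hc[OF f(1)]]
      by (intro PC_hat.inv_equality) (simp_all add: \<phi>_comp one bij_is_inj)
    ultimately show "m_inv PC_hat a \<in> \<phi> ` H" by blast
    fix b assume "b \<in> \<phi> ` H"
    then show "a \<otimes>\<^bsub>PC_hat\<^esub> b \<in> \<phi> ` H"
      using f subgroup.m_closed[OF sub] by (auto simp: \<phi>_comp)
  qed
  have proj: "pc_proj (\<phi> f) = pc_proj f" if "f \<in> H" for f
    using that \<phi>c Hc finite_neq_conj[OF \<sigma>] bij_PC_hat by (simp add: pc_proj_eq_iff \<phi>_def)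
  have "bij_betw (pc_proj \<circ> \<phi>) H \<Gamma>"
    using bb proj by (simp cong: bij_betw_cong)
  moreover have "inj_on \<phi> H"
    using inj_on_imageI2[of pc_proj \<phi> H] calculation bij_betw_imp_inj_on by blast
  ultimately show "bij_betw pc_proj ((\<lambda>f. \<sigma> \<circ> f \<circ> inv \<sigma>) ` H) \<Gamma>"
    unfolding \<phi>_def[symmetric] by (metis bij_betw_comp_iff inj_on_imp_bij_betw)
qed


section \<open>Elements of a lift and the lifted rotations\<close>

locale lift = iet_overgroup +
  fixes H :: "(circle \<Rightarrow> circle) set"
  assumes lift: "is_lift \<Gamma> H"
begin

lemma H_grp: "f \<in> H \<Longrightarrow> f \<in> grp"
  using lift subgroup.subset unfolding is_lift_def grp_def bij_betw_def by blast

lemma H_id: "id \<in> H"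
  using lift subgroup.one_closed[of H PC_hat] by (auto simp: is_lift_def)

lemma H_comp: "f \<in> H \<Longrightarrow> g \<in> H \<Longrightarrow> f \<circ> g \<in> H"
  using lift subgroup.m_closed[of H PC_hat f g] by (auto simp: is_lift_def)

lemma H_inv: "f \<in> H \<Longrightarrow> inv f \<in> H"
  using lift subgroup.m_inv_closed[of H PC_hat f] grp_PC_hat[OF H_grp] by (auto simp: is_lift_def)

lemma H_bij: "f \<in> H \<Longrightarrow> bij f"
  by (simp add: H_grp grp_bij)

text \<open>This is injectivity of the projection on \<open>H\<close>: identities between elements
  of \<open>H\<close> need checking only off a finite set.\<close>

lemma H_unique: "f \<in> H \<Longrightarrow> g \<in> H \<Longrightarrow> finite {x. f x \<noteq> g x} \<Longrightarrow> f = g"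
  using lift inj_onD[of pc_proj H f g] pc_proj_eq_iff[of f g]
  by (simp add: is_lift_def bij_betw_def grp_PC_hat H_grp)

lemma H_lift:
  assumes "f \<in> grp"
  obtains h where "h \<in> H" "finite {x. h x \<noteq> f x}"
proof -
  have "pc_proj f \<in> pc_proj ` H" using assms lift by (simp add: is_lift_def bij_betw_def grp_def)
  then obtain h where h: "h \<in> H" "pc_proj h = pc_proj f" by force
  then have "finite {x. h x \<noteq> f x}" using assms by (simp add: pc_proj_eq_iff grp_PC_hat H_grp)
  with h that show ?thesis by blast
qed

definition rot :: "circle \<Rightarrow> circle \<Rightarrow> circle"
  where "rot c = (SOME h. h \<in> H \<and> finite {x. h x \<noteq> x + c})"

lemma rot: "rot c \<in> H" "finite {x. rot c x \<noteq> x + c}"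
proof -
  have "\<exists>h. h \<in> H \<and> finite {x. h x \<noteq> x + c}" using H_lift[OF grp_rotation] by blast
  then have "rot c \<in> H \<and> finite {x. rot c x \<noteq> x + c}" unfolding rot_def by (rule someI_ex)
  then show "rot c \<in> H" "finite {x. rot c x \<noteq> x + c}" by blast+
qed

lemma rot_add: "rot a \<circ> rot b = rot (b + a)"
proof (rule H_unique)
  have "finite {x. (rot a \<circ> rot b) x \<noteq> ((\<lambda>x. x + a) \<circ> (\<lambda>x. x + b)) x}"
    using rot H_bij by (intro finite_neq_comp) auto
  then have *: "finite {x. (rot a \<circ> rot b) x \<noteq> x + (b + a)}" by (simp add: add.assoc)
  show "finite {x. (rot a \<circ> rot b) x \<noteq> rot (b + a) x}"
    using finite_neq_trans[OF *] finite_neq_sym[OF rot(2)] by blast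
qed (simp_all add: rot H_comp)

lemma rot_0: "rot 0 = id"
  using rot(2)[of 0] by (intro H_unique) (simp_all add: rot H_id)

lemma lift_subset_reps_imp_eq: "side G \<Longrightarrow> K \<subseteq> reps G \<Longrightarrow> is_lift \<Gamma> K \<Longrightarrow> K = reps G"
proof
  assume K: "side G" "K \<subseteq> reps G" "is_lift \<Gamma> K"
  show "reps G \<subseteq> K"
  proof
    fix f assume f: "f \<in> reps G"
    have R: "bij_betw pc_proj (reps G) \<Gamma>" using is_lift_reps K by (simp add: is_lift_def)
    then have "pc_proj f \<in> pc_proj ` K" using K f by (auto simp: is_lift_def bij_betw_def)
    then obtain k where k: "k \<in> K" "pc_proj k = pc_proj f" by force
    then have "k = f" using R f K(2) by (auto simp: bij_betw_def dest: inj_onD)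
    then show "f \<in> K" using k by simp
  qed
qed

text \<open>
  The orbit map of the generic value \<open>p\<close> of \<open>a \<mapsto> rot (- a) a\<close> intertwines the true rotations
  with their lifts.
\<close>

lemma ex_conj_rotations:
  "\<exists>\<sigma>\<in>fin_supp. \<forall>c. (\<lambda>x. x + c) \<in> conj_by \<sigma> H"
proof -
  define h where "h a = rot (- a) a" for a
  have "finite {a. h (a + b) \<noteq> h a}" for b
  proof -
    \<comment> \<open>By the additive law for \<open>rot\<close>, \<open>h (a + b) = h a\<close> as
      soon as \<open>rot (- b)\<close> acts on \<open>a + b\<close> as the true rotation.\<close>
    have "{a. h (a + b) \<noteq> h a} \<subseteq> (\<lambda>a. a + b) -` {y. rot (- b) y \<noteq> y + - b}"
    proof (rule subsetI, rule ccontr)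
      fix a assume a: "a \<in> {a. h (a + b) \<noteq> h a}"
        "a \<notin> (\<lambda>a. a + b) -` {y. rot (- b) y \<noteq> y + - b}"
      then have ne: "h (a + b) \<noteq> h a" and eq: "rot (- b) (a + b) = a" by auto
      have "- (a + b) = - b + - a" by simp
      then have "h (a + b) = (rot (- a) \<circ> rot (- b)) (a + b)" by (simp only: h_def rot_add)
      also have "\<dots> = h a" using eq by (simp add: h_def)
      finally show False using ne by simp
    qed
    moreover have "finite ((\<lambda>a. a + b) -` {y. rot (- b) y \<noteq> y + - b})"
      by (intro finite_vimageI rot) (simp add: inj_def)
    ultimately show ?thesis by (rule finite_subset)
  qed
  then obtain p where p: "finite {a. h a \<noteq> p}"
    using almost_invariant_imp_almost_constant[OF uncountable_circle] by blast
  define \<tau> where "\<tau> a = rot a p" for a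
  have gen: "\<tau> a = a" if "h a = p" for a
  proof -
    have "\<tau> a = (rot a \<circ> rot (- a)) a" using that by (simp add: \<tau>_def h_def)
    then show ?thesis by (simp add: rot_add rot_0)
  qed
  have fin: "finite {a. \<tau> a \<noteq> a}" by (rule finite_subset[OF _ p]) (use gen in auto)
  have \<tau>_add: "\<tau> (a + c) = rot c (\<tau> a)" for a c
    using rot_add[of c a] by (simp add: \<tau>_def fun_eq_iff)
  have "inj \<tau>"
  proof (rule injI)
    fix a b assume ab: "\<tau> a = \<tau> b"
    \<comment> \<open>Shifting \<open>a\<close> and \<open>b\<close> by a common generic
      \<open>c\<close> lands where \<open>\<tau>\<close> is the identity, while
      \<open>\<tau>_add\<close> preserves the equality of the two values.\<close>
    have "finite ((\<lambda>c. a + c) -` {x. \<tau> x \<noteq> x} \<union> (\<lambda>c. b + c) -` {x. \<tau> x \<noteq> x})"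
      by (intro finite_UnI finite_vimageI fin) (simp_all add: inj_def)
    then obtain c where "c \<notin> (\<lambda>c. a + c) -` {x. \<tau> x \<noteq> x} \<union> (\<lambda>c. b + c) -` {x. \<tau> x \<noteq> x}"
      using uncountable_circle countable_finite by (metis UNIV_eq_I)
    then have "a + c = b + c" using \<tau>_add[of a c] \<tau>_add[of b c] ab by simp
    then show "a = b" by simp
  qed
  then have \<tau>: "\<tau> \<in> fin_supp" using fin by (rule fin_supp_bijI)
  then have b\<tau>: "bij \<tau>" by (simp add: fin_supp_def)
  have \<sigma>: "inv \<tau> \<in> fin_supp"
    using subgroup.m_inv_closed[OF subgroup_fin_supp \<tau>] \<tau> fin_supp_subset by (auto simp: subset_iff)
  \<comment> \<open>Conjugation by \<open>\<tau>\<close> turns true rotations into lifted ones, so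
    the required permutation is its inverse.\<close>
  have "(\<lambda>x. x + c) = inv \<tau> \<circ> rot c \<circ> inv (inv \<tau>)" for c
    using b\<tau> \<tau>_add[of _ c, symmetric] by (simp add: inv_inv_eq fun_eq_iff bij_is_inj)
  then have "(\<lambda>x. x + c) \<in> conj_by (inv \<tau>) H" for c
    unfolding conj_by_fin_supp[OF \<sigma>] using rot(1) by blast
  then show ?thesis using \<sigma> by blast
qed

text \<open>The conjugate of \<open>rot c\<close> equals its own one-sided limit and agrees with the
  rotation off a finite set, so the two coincide everywhere.\<close>

lemma conj_rot:
  assumes \<sigma>: "\<sigma> \<in> fin_supp" and G: "side G" and eq: "conj_by \<sigma> H = reps G"
  shows "\<sigma> (rot c x) = \<sigma> x + c"
proof -
  have b\<sigma>: "bij \<sigma>" using \<sigma> by (simp add: fin_supp_def)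
  let ?f = "\<sigma> \<circ> rot c \<circ> inv \<sigma>"
  have "?f \<in> reps G" using rot(1) by (auto simp: eq[symmetric] conj_by_fin_supp[OF \<sigma>])
  moreover have "finite {x. ?f x \<noteq> x + c}"
    using finite_neq_trans[OF finite_neq_conj[OF \<sigma> H_bij[OF rot(1)]] rot(2)] .
  ultimately have "?f y = y + c" for y
    using olim_cong[OF G, of ?f "\<lambda>x. x + c"] olim_rotation[OF G] by (simp add: reps_def)
  from this[of "\<sigma> x"] show ?thesis using b\<sigma> by (simp add: bij_is_inj)
qed

text \<open>The difference of \<open>\<tau>\<close> and \<open>\<sigma>\<close> is constant along
  orbits of \<open>rot\<close>, which acts transitively, and it vanishes at any point fixed by both.
  Separate sides \<open>G\<close> and \<open>G'\<close> also exclude normalizations to different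
  one-sided lifts by different permutations.\<close>

lemma conj_unique:
  assumes "\<sigma> \<in> fin_supp" "side G" "conj_by \<sigma> H = reps G"
    and "\<tau> \<in> fin_supp" "side G'" "conj_by \<tau> H = reps G'"
  shows "\<sigma> = \<tau>"
proof -
  have b: "bij \<sigma>" "finite {x. \<sigma> x \<noteq> x}" "finite {x. \<tau> x \<noteq> x}"
    using assms by (auto simp: fin_supp_def)
  define d where "d x = \<tau> x - \<sigma> x" for x
  have d_rot: "d (rot c x) = d x" for c x
    using conj_rot[OF assms(1-3)] conj_rot[OF assms(4-6)] by (simp add: d_def)
  have "d x = 0" for x
  proof -
    have "finite ({x. \<sigma> x \<noteq> x} \<union> {x. \<tau> x \<noteq> x})" using b by simp
    then obtain y where y: "y \<notin> {x. \<sigma> x \<noteq> x} \<union> {x. \<tau> x \<noteq> x}"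
      using uncountable_circle countable_finite by (metis UNIV_eq_I)
    have "\<sigma> (rot (\<sigma> y - \<sigma> x) x) = \<sigma> y" by (simp add: conj_rot[OF assms(1-3)])
    then have "rot (\<sigma> y - \<sigma> x) x = y" using b(1) by (simp add: bij_is_inj inj_eq)
    then have "d x = d y" using d_rot by metis
    then show ?thesis using y by (simp add: d_def)
  qed
  then show ?thesis by (auto simp: d_def)
qed

end


section \<open>Lifts containing the rotations\<close>

locale rotation_lift = lift +
  assumes rotation_H: "\<And>c. (\<lambda>x. x + c) \<in> H"
begin

text \<open>
  A lift of an exchange of two small arcs agrees with the exchange at a given point \<open>x\<close> after
  being conjugated by a suitable small rotation, which moves \<open>x\<close> away from the finitely many
  points where it differs.
\<close>

lemma ex_swap:
  assumes U: "open U" "x \<in> U" "x + c \<in> U" and c: "c \<noteq> 0"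
  obtains k where "k \<in> H" "k x = x + c" "finite {z. z \<notin> U \<and> k z \<noteq> z}"
    "finite {z. z \<in> U \<and> k z \<notin> U}" "eventually (\<lambda>z. k z = z + c) (at x)"
proof -
  obtain t where t: "x = circ t" using circ_surj by blast
  obtain P Q where PQ: "open P" "open Q" "x \<in> P" "x + c \<in> Q" "P \<inter> Q = {}"
    using hausdorff[of x "x + c"] c by auto
  have pre: "open ((\<lambda>x. x + c) -` (U \<inter> Q))"
    using U PQ isCont_add_circle by (intro open_vimage) (auto intro: continuous_at_imp_continuous_on)
  \<comment> \<open>\<open>W\<close> and its translate by \<open>c\<close> are disjoint and lie in
    \<open>U\<close>, so exchanging an arc in \<open>W\<close> with its translate moves only points
    of \<open>U\<close>.\<close>
  define W where "W = U \<inter> P \<inter> (\<lambda>x. x + c) -` (U \<inter> Q)"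
  have W: "open W" "x \<in> W" using U PQ pre by (auto simp: W_def)
  then have "open (circ -` W)" "t \<in> circ -` W" by (auto simp: open_circle_def t)
  then obtain e where e: "e > 0" "ball t e \<subseteq> circ -` W" by (rule openE)
  \<comment> \<open>Half the radius leaves room for the later shift by \<open>t - s\<close>, which
    is smaller than \<open>e/2\<close> in absolute value.\<close>
  define A where "A = circ ` {t - e/2<..<t + e/2}"
  have "A \<subseteq> W" using e by (auto simp: A_def dist_real_def subset_iff)
  have disj: "y + c \<notin> W" if "y \<in> W" for y using that PQ(5) by (auto simp: W_def)
  then have sw: "swap A c \<in> grp"
    using \<open>A \<subseteq> W\<close> unfolding A_def
    by (intro grp_translation bij_swap piecewise_translation_swap) blast
  obtain h where h: "h \<in> H" "finite {z. h z \<noteq> swap A c z}" using H_lift[OF sw] .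
  have "eventually (\<lambda>y. y \<notin> {z. h z \<noteq> swap A c z}) (at (circ t))"
    by (rule eventually_at_not_in_finite[OF h(2)])
  then have "eventually (\<lambda>s. h (circ s) = swap A c (circ s)) (at t)"
    by (simp add: eventually_filtermap flip: filtermap_circ_at)
  moreover have "eventually (\<lambda>s. s \<in> ball t (e/2)) (at t)"
    using e by (intro eventually_at_in_open') auto
  ultimately have "eventually (\<lambda>s. h (circ s) = swap A c (circ s) \<and> s \<in> ball t (e/2)) (at t)"
    by (rule eventually_conj)
  then obtain s where s: "h (circ s) = swap A c (circ s)" "\<bar>t - s\<bar> < e / 2"
    using eventually_happens'[OF at_neq_bot] by (auto simp: dist_real_def)
  define \<theta> where "\<theta> = circ (t - s)"
  define B where "B = circ ` {t - e/2 + (t - s)<..<t + e/2 + (t - s)}"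
  have BA: "z \<in> B \<longleftrightarrow> z - \<theta> \<in> A" for z
  proof
    assume "z \<in> B"
    then obtain r where r: "z = circ r" "t - e/2 + (t - s) < r" "r < t + e/2 + (t - s)"
      by (auto simp: B_def)
    have "z - \<theta> = circ (r - (t - s))"
      using circ_add[of "r - (t - s)" "t - s"] by (simp add: \<theta>_def r(1))
    then show "z - \<theta> \<in> A" using r by (auto simp: A_def)
  next
    assume "z - \<theta> \<in> A"
    then obtain r where r: "z - \<theta> = circ r" "t - e/2 < r" "r < t + e/2" by (auto simp: A_def)
    then have "z = circ r + circ (t - s)" by (simp add: \<theta>_def algebra_simps)
    then have "z = circ (r + (t - s))" by (simp only: circ_add)
    then show "z \<in> B" using r by (auto simp: B_def)
  qed
  have B: "B \<subseteq> W" "open B" "x \<in> B"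
  proof -
    have "{t - e/2 + (t - s)<..<t + e/2 + (t - s)} \<subseteq> ball t e"
    proof
      fix r assume "r \<in> {t - e/2 + (t - s)<..<t + e/2 + (t - s)}"
      then have "\<bar>t - r\<bar> < e" using s(2) unfolding greaterThanLessThan_iff by linarith
      then show "r \<in> ball t e" by (simp add: dist_real_def)
    qed
    then show "B \<subseteq> W" using e(2) unfolding B_def by blast
    show "open B" unfolding B_def by (intro open_circ_image) auto
    show "x \<in> B" using s(2) unfolding B_def t by (intro imageI) (auto simp: abs_if split: if_splits)
  qed
  \<comment> \<open>The rotation by \<open>\<theta>\<close> carries \<open>circ s\<close>, where
    \<open>h\<close> agrees with the exchange, to \<open>x\<close>.\<close>
  define k where "k = (\<lambda>x. x + \<theta>) \<circ> (h \<circ> (\<lambda>x. x + - \<theta>))"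
  have kH: "k \<in> H" unfolding k_def using h rotation_H by (intro H_comp)
  have swapB: "swap A c (z - \<theta>) + \<theta> = swap B c z" for z
    by (simp add: swap_def BA algebra_simps)
  have "finite ((\<lambda>z. z - \<theta>) -` {z. h z \<noteq> swap A c z})"
    by (intro finite_vimageI h) (simp add: inj_def)
  then have fin: "finite {z. k z \<noteq> swap B c z}"
    by (rule rev_finite_subset) (auto simp: k_def simp flip: swapB)
  have "x - \<theta> = circ s"
    using circ_add[of s "t - s"] by (simp add: t \<theta>_def)
  then have "k x = swap B c x"
    using s(1) swapB[of x] by (simp add: k_def)
  then have kx: "k x = x + c" using B by (simp add: swap_def)
  have out: "swap B c z = z" if "z \<notin> U" for z
    using that B(1) by (auto simp: swap_def W_def)
  have into: "swap B c z \<in> U" if "z \<in> U" for z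
    using that B(1) by (auto simp: swap_def W_def)
  have "{z. z \<in> U \<and> k z \<notin> U} \<subseteq> {z. k z \<noteq> swap B c z}"
  proof
    fix z assume "z \<in> {z. z \<in> U \<and> k z \<notin> U}"
    then have "swap B c z \<in> U" "k z \<notin> U" using into by blast+
    then show "z \<in> {z. k z \<noteq> swap B c z}" by auto
  qed
  then have "finite {z. z \<in> U \<and> k z \<notin> U}" using fin by (rule finite_subset)
  moreover have "finite {z. z \<notin> U \<and> k z \<noteq> z}"
    by (intro finite_subset[OF _ fin]) (use out in auto)
  moreover have "eventually (\<lambda>z. k z = z + c) (at x)"
  proof -
    have "eventually (\<lambda>z. z \<in> B) (at x)" using B by (intro eventually_at_in_open')
    moreover have "eventually (\<lambda>z. z \<notin> {z. k z \<noteq> swap B c z}) (at x)"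
      by (rule eventually_at_not_in_finite[OF fin])
    ultimately show ?thesis by eventually_elim (simp add: swap_def)
  qed
  ultimately show ?thesis using that kH kx by blast
qed

text \<open>An element of \<open>H\<close> that is the identity near \<open>x\<close> commutes with an exchange moving \<open>x\<close>.\<close>

lemma fixes_point:
  assumes f: "f \<in> H" and id: "eventually (\<lambda>s. f s = s) (at x)"
  shows "f x = x"
proof (rule ccontr)
  assume ne: "f x \<noteq> x"
  obtain U where U: "open U" "x \<in> U" "\<And>s. s \<in> U \<Longrightarrow> s \<noteq> x \<Longrightarrow> f s = s"
    using id by (auto simp: eventually_at_topological)
  have "eventually (\<lambda>s. s \<in> U - {x}) (at x)" using U by (intro eventually_at_in_open)
  then obtain s where s: "s \<in> U" "s \<noteq> x"
    using eventually_happens'[OF at_circle_neq_bot] by blast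
  obtain k where k: "k \<in> H" "k x = x + (s - x)" "finite {z. z \<notin> U \<and> k z \<noteq> z}"
    "finite {z. z \<in> U \<and> k z \<notin> U}"
    using ex_swap[OF U(1,2), of "s - x"] s by auto
  have bf: "bij f" and bk: "bij k" using f k H_bij by auto
  \<comment> \<open>Off \<open>E\<close> the maps commute: for \<open>z\<close> in \<open>U\<close>,
    \<open>f\<close> fixes \<open>z\<close> and \<open>k z\<close>; for \<open>z\<close> outside
    \<open>U\<close>, \<open>k\<close> fixes \<open>z\<close> and \<open>f z\<close>.\<close>
  define E where "E = {z. z \<in> U \<and> k z \<notin> U} \<union> {z. z \<notin> U \<and> k z \<noteq> z} \<union> {x}
    \<union> {z. f z \<in> {z. z \<notin> U \<and> k z \<noteq> z} \<union> {x}} \<union> {z. k z \<in> {x}}"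
  have "finite E" unfolding E_def
    by (intro finite_UnI k(3,4) finite_vimage_bij[OF bf] finite_vimage_bij[OF bk]) simp_all
  moreover have "{z. (f \<circ> k) z \<noteq> (k \<circ> f) z} \<subseteq> E"
  proof -
    have "f (k z) = k (f z)" if "z \<notin> E" for z
    proof (cases "z \<in> U")
      case True
      then have "f z = z" "f (k z) = k z" using that U(3) by (auto simp: E_def)
      then show ?thesis by simp
    next
      case False
      have "f z \<notin> U"
      proof
        assume "f z \<in> U"
        moreover have "f z \<noteq> x" using that by (auto simp: E_def)
        ultimately have "f (f z) = f z" by (rule U(3))
        then have "f z = z" using bf by (simp add: bij_is_inj inj_eq)
        then show False using \<open>f z \<in> U\<close> False by simp
      qed
      then show ?thesis using that False by (auto simp: E_def)
    qed
    then show ?thesis by auto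
  qed
  ultimately have "f \<circ> k = k \<circ> f"
    using finite_subset f k by (intro H_unique H_comp) auto
  then have "f (k x) = k (f x)" by (metis comp_apply)
  \<comment> \<open>\<open>k x\<close> is \<open>s\<close>, a point of \<open>U\<close> other than
    \<open>x\<close>, hence fixed by \<open>f\<close>.\<close>
  moreover have "f (k x) = k x" using s U(3)[of s] k(2) by simp
  ultimately have "x = f x" using bk by (simp add: bij_is_inj inj_eq)
  then show False using ne by simp
qed

text \<open>Otherwise an exchange near \<open>f x\<close>, conjugated back by \<open>f\<close>, is the identity near \<open>x\<close> but
  moves \<open>x\<close>.\<close>

lemma value_is_one_sided_limit:
  assumes f: "f \<in> H"
  shows "f x = olim (at_left 0) f x \<or> f x = olim (at_right 0) f x"
proof (rule ccontr)
  define p q z where "p = olim (at_left 0) f x" and "q = olim (at_right 0) f x" and "z = f x"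
  assume "\<not> ?thesis"
  then have "z \<noteq> p" "z \<noteq> q" by (auto simp: p_def q_def z_def)
  then obtain P P' Q Q' where "open P" "open P'" "z \<in> P" "p \<in> P'" "P \<inter> P' = {}"
    "open Q" "open Q'" "z \<in> Q" "q \<in> Q'" "Q \<inter> Q' = {}"
    using hausdorff by metis
  \<comment> \<open>Intersecting the neighbourhoods of \<open>z\<close> and uniting those of
    \<open>p\<close> and \<open>q\<close> separates \<open>z\<close> from both limits at
    once.\<close>
  then obtain U V where UV: "open U" "z \<in> U" "open V" "p \<in> V" "q \<in> V" "U \<inter> V = {}"
    using that[of "P \<inter> Q" "P' \<union> Q'"] by blast
  have "eventually (\<lambda>s. s \<in> U - {z}) (at z)" using UV by (intro eventually_at_in_open)
  then obtain s where s: "s \<in> U" "s \<noteq> z"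
    using eventually_happens'[OF at_circle_neq_bot] by blast
  obtain k where k: "k \<in> H" "k z = z + (s - z)" "finite {z. z \<notin> U \<and> k z \<noteq> z}"
    using ex_swap[OF UV(1,2), of "s - z"] s by auto
  define h where "h = inv f \<circ> (k \<circ> f)"
  have bf: "bij f" using f H_bij by auto
  have ev: "eventually (\<lambda>s. h s = s) (germ G x)" if G: "side G" and V: "olim G f x \<in> V" for G
  proof -
    have "eventually (\<lambda>y. y \<in> V) (germ G (olim G f x))"
      using V UV(3) germ_le_nhds[OF G] eventually_nhds_in_open filter_leD by blast
    moreover have "eventually (\<lambda>y. y \<notin> {z. z \<notin> U \<and> k z \<noteq> z}) (germ G (olim G f x))"
      by (rule eventually_germ_not_in_finite[OF G k(3)])
    ultimately have "eventually (\<lambda>y. k y = y) (germ G (olim G f x))"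
      by eventually_elim (use UV(6) in auto)
    then have "eventually (\<lambda>y. k y = y) (filtermap f (germ G x))"
      unfolding filtermap_germ[OF G H_grp[OF f]] .
    then have "eventually (\<lambda>s. k (f s) = f s) (germ G x)" by (simp add: eventually_filtermap)
    then show ?thesis by eventually_elim (simp add: h_def bf bij_is_inj)
  qed
  have "eventually (\<lambda>s. h s = s) (at x)"
    using ev[OF side_left] ev[OF side_right] UV
    by (simp add: at_eq_sup_germs eventually_sup p_def q_def)
  moreover have "h \<in> H" unfolding h_def using f k(1) by (intro H_comp H_inv)
  ultimately have "h x = x" by (intro fixes_point)
  then have "inv f (k z) = x" by (simp add: h_def z_def)
  then have "k z = f x" using bf by (metis bij_inv_eq_iff)
  then show False using k(2) s by (simp add: z_def)
qed

text \<open>Both one-sided limits of \<open>inv g \<circ> f\<close> at \<open>x\<close> are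
  \<open>x\<close>, so this element of \<open>H\<close> fixes \<open>x\<close>.\<close>

lemma value_determined_by_limits:
  assumes f: "f \<in> H" and g: "g \<in> H" and eq: "\<And>G. side G \<Longrightarrow> olim G f x = olim G g x"
  shows "f x = g x"
proof -
  have h: "inv g \<circ> f \<in> H" using f g by (intro H_comp H_inv)
  have "olim G (inv g \<circ> f) x = x" if "side G" for G
    using that f g eq H_grp grp_inv by (simp add: olim_comp olim_inv)
  then have "inv g (f x) = x"
    using value_is_one_sided_limit[OF h, of x] side_left side_right by simp
  then show ?thesis using H_bij[OF g] by (metis bij_inv_eq_iff)
qed

text \<open>
  After rotations both elements have the same left limit; an exchange carries the right limit of
  the first to that of the second, where the two values lie on opposite sides.
\<close>

lemma sides_coherent:
  assumes f: "f \<in> H" "f x \<noteq> olim (at_right 0) f x" and g: "g \<in> H" "g y \<noteq> olim (at_left 0) g y"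
  shows False
proof -
  let ?L = "at_left (0::real)" and ?R = "at_right (0::real)"
  define p' q' where "p' = olim ?L g y" and "q' = olim ?R g y"
  have q': "g y = q'" "p' \<noteq> q'"
    using value_is_one_sided_limit[OF g(1), of y] g(2) by (auto simp: p'_def q'_def)
  \<comment> \<open>The inner rotation moves \<open>y\<close> to \<open>x\<close>; the outer one
    aligns the left limit with that of \<open>g\<close>.\<close>
  define f1 where "f1 = (\<lambda>z. z + (p' - olim ?L f x)) \<circ> (f \<circ> (\<lambda>z. z + (x - y)))"
  have f1: "f1 \<in> H" unfolding f1_def using f(1) rotation_H by (intro H_comp)
  define r where "r = olim ?R f x + (p' - olim ?L f x)"
  have lim_f1: "olim G f1 y = olim G f x + (p' - olim ?L f x)" if "side G" for G
    using that f(1) by (simp add: f1_def olim_comp olim_rotation grp_rotation grp_comp H_grp)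
  have f1L: "olim ?L f1 y = p'" and f1R: "olim ?R f1 y = r"
    by (simp_all add: lim_f1 side_left side_right r_def)
  have fx: "f x = olim ?L f x" using value_is_one_sided_limit[OF f(1), of x] f(2) by auto
  have f1y: "f1 y = p'" using fx by (simp add: f1_def)
  have "r \<noteq> p'" using fx f(2) by (simp add: r_def)
  show False
  proof (cases "r = q'")
    case True
    have "olim G f1 y = olim G g y" if "side G" for G
      using that f1L f1R True by (metis side_def p'_def q'_def)
    then have "f1 y = g y" by (rule value_determined_by_limits[OF f1 g(1)])
    then show False using f1y q' by simp
  next
    case False
    obtain P P' Q Q' where "open P" "open P'" "r \<in> P" "p' \<in> P'" "P \<inter> P' = {}"
      "open Q" "open Q'" "q' \<in> Q" "p' \<in> Q'" "Q \<inter> Q' = {}"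
      using hausdorff \<open>r \<noteq> p'\<close> q'(2) by metis
    \<comment> \<open>\<open>U\<close> contains both right limits, so the exchange can take place
      inside it; \<open>V\<close> protects the common left limit \<open>p'\<close>.\<close>
    then obtain U V where UV: "open U" "r \<in> U" "q' \<in> U" "open V" "p' \<in> V" "U \<inter> V = {}"
      using that[of "P \<union> Q" "P' \<inter> Q'"] by blast
    obtain k where k: "k \<in> H" "k r = r + (q' - r)" "finite {z. z \<notin> U \<and> k z \<noteq> z}"
      "eventually (\<lambda>z. k z = z + (q' - r)) (at r)"
      using ex_swap[OF UV(1,2), of "q' - r"] UV(3) False by auto
    have "eventually (\<lambda>z. k z = z + 0) (germ ?L p')"
    proof -
      have "eventually (\<lambda>z. z \<in> V) (germ ?L p')"
        using UV germ_le_nhds[OF side_left] eventually_nhds_in_open filter_leD by blast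
      moreover have "eventually (\<lambda>z. z \<notin> {z. z \<notin> U \<and> k z \<noteq> z}) (germ ?L p')"
        by (rule eventually_germ_not_in_finite[OF side_left k(3)])
      ultimately show ?thesis by eventually_elim (use UV(6) in auto)
    qed
    then have kL: "olim ?L k p' = p'" using olim_eventually_rotation[OF side_left] by fastforce
    have "eventually (\<lambda>z. k z = z + (q' - r)) (germ ?R r)"
      using k(4) germ_le_at[OF side_right] filter_leD by blast
    then have kR: "olim ?R k r = q'" using olim_eventually_rotation[OF side_right] by fastforce
    have "olim ?L (k \<circ> f1) y = p'" "olim ?R (k \<circ> f1) y = q'"
      using f1L f1R kL kR H_grp[OF k(1)] H_grp[OF f1]
      by (simp_all add: olim_comp side_left side_right)
    then have "olim G (k \<circ> f1) y = olim G g y" if "side G" for G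
      using that by (metis side_def p'_def q'_def)
    then have "(k \<circ> f1) y = g y" by (rule value_determined_by_limits[OF H_comp[OF k(1) f1] g(1)])
    \<comment> \<open>The values at \<open>y\<close> are \<open>k p'\<close> on one side and
      \<open>q' = k r\<close> on the other, against injectivity of \<open>k\<close>.\<close>
    then have "k p' = k r" using f1y q' k(2) by simp
    then show False using \<open>r \<noteq> p'\<close> H_bij[OF k(1)] by (simp add: bij_is_inj inj_eq)
  qed
qed

text \<open>One element missing its right limit somewhere forces, by \<open>sides_coherent\<close>,
  every element to take its left limits everywhere. Inclusion between two lifts is then
  equality.\<close>

lemma eq_one_sided_reps: "H = reps (at_left 0) \<or> H = reps (at_right 0)"
proof -
  have "H \<subseteq> reps (at_left 0) \<or> H \<subseteq> reps (at_right 0)"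
    using sides_coherent H_grp unfolding reps_def subset_iff by fastforce
  then show ?thesis
    using lift_subset_reps_imp_eq lift side_left side_right by blast
qed

end

section \<open>Distinctness of the two lifts and the classification\<close>

text \<open>Exchanging the arc from 0 to 1/4 with its translate by 1/4 gives left limit 0 and right
  limit 1/4 at 0, so the left-continuous representative is not right-continuous.\<close>

lemma (in iet_overgroup) left_reps_neq_right_reps: "reps (at_left 0) \<noteq> reps (at_right 0)"
proof
  assume eq: "reps (at_left 0) = reps (at_right 0)"
  define A where "A = circ ` {0<..<1/4}"
  define s where "s = swap A (circ (1/4))"
  \<comment> \<open>The range covers \<open>r\<close> and \<open>r - 1/4\<close> for
    \<open>r\<close> between -1/4 and 0, the two points tested in \<open>swap\<close>.\<close>
  have A: "circ r \<in> A \<longleftrightarrow> 0 < r" if "-1/2 < r" "r < 1/4" for r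
  proof
    assume "circ r \<in> A"
    then obtain u where u: "0 < u" "u < 1/4" "r - u \<in> \<int>" by (auto simp: A_def circ_eq_iff)
    then obtain n where n: "r - u = of_int n" by (auto elim: Ints_cases)
    then have "-1 < real_of_int n" "real_of_int n < 1" using u that by linarith+
    then have "n = 0" by linarith
    then show "0 < r" using n u by simp
  qed (use that in \<open>auto simp: A_def\<close>)
  have disj: "x + circ (1/4) \<notin> A" if "x \<in> A" for x
  proof
    assume "x + circ (1/4) \<in> A"
    with that obtain u v :: real
      where uv: "0 < u" "u < 1/4" "0 < v" "v < 1/4" "u + 1/4 - v \<in> \<int>"
      by (auto simp: A_def circ_eq_iff simp flip: circ_add)
    then obtain n where "u + 1/4 - v = of_int n" by (auto elim: Ints_cases)
    then have "0 < real_of_int n" "real_of_int n < 1" using uv(1-4) by linarith+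
    then have "0 < n" "n < 1" by (simp_all only: of_int_0_less_iff of_int_less_1_iff)
    then show False by simp
  qed
  have sg: "s \<in> grp" unfolding s_def using disj
    by (intro grp_translation bij_swap) (auto simp: A_def intro: piecewise_translation_swap)
  have "eventually (\<lambda>r. s (circ r) = circ r + 0) (at_left 0)"
    unfolding eventually_at_left_field
  proof (intro exI[of _ "-1/4"] conjI allI impI)
    fix r :: real assume r: "-1/4 < r" "r < 0"
    have "circ r - circ (1/4) = circ (r - 1/4)"
      using circ_add[of "r - 1/4" "1/4"] by simp
    then show "s (circ r) = circ r + 0" using r A[of r] A[of "r - 1/4"] by (simp add: s_def swap_def)
  qed simp
  then have "eventually (\<lambda>x. s x = x + 0) (germ (at_left 0) 0)"
    by (simp add: germ_def eventually_filtermap)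
  then have L: "olim (at_left 0) s 0 = 0" using olim_eventually_rotation[OF side_left] by fastforce
  have "eventually (\<lambda>r. s (circ r) = circ r + circ (1/4)) (at_right 0)"
    unfolding eventually_at_right_field
    by (intro exI[of _ "1/4"]) (auto simp: s_def swap_def A)
  then have "eventually (\<lambda>x. s x = x + circ (1/4)) (germ (at_right 0) 0)"
    by (simp add: germ_def eventually_filtermap)
  then have R: "olim (at_right 0) s 0 = circ (1/4)"
    using olim_eventually_rotation[OF side_right] by fastforce
  define f where "f = olim (at_left 0) s"
  have f: "f \<in> reps (at_left 0)" unfolding f_def by (rule olim_reps[OF side_left sg])
  then have "f 0 = olim (at_right 0) f 0" unfolding eq by (simp add: reps_def)
  also have "\<dots> = circ (1/4)"
    unfolding R[symmetric] f_def
    by (rule olim_cong[OF side_right finite_neq_sym[OF finite_olim_neq[OF side_left sg]]])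
  finally have "circ (1/4) = circ 0" by (simp add: f_def L circ_0)
  then have "(1/4::real) \<in> \<int>" by (simp add: circ_eq_iff)
  then obtain n where "(1/4::real) = of_int n" by (auto elim: Ints_cases)
  then have "4 * n = 1" by linarith
  then show False by presburger
qed

theorem corollary4p15:
  fixes \<Gamma> :: "(circle \<Rightarrow> circle) set set"
  assumes "subgroup \<Gamma> PC" and "\<Gamma> \<subseteq> PC_plus" and "IET_plus \<subseteq> \<Gamma>"
  shows "is_lift \<Gamma> (left_reps \<Gamma>) \<and> is_lift \<Gamma> (right_reps \<Gamma>) \<and> left_reps \<Gamma> \<noteq> right_reps \<Gamma> \<and>
    (\<forall>H. is_lift \<Gamma> H \<longrightarrow>
      (\<exists>!\<sigma>. \<sigma> \<in> fin_supp \<and> (conj_by \<sigma> H = left_reps \<Gamma> \<or> conj_by \<sigma> H = right_reps \<Gamma>)))"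
proof -
  interpret iet_overgroup \<Gamma> using assms by (rule iet_overgroup.intro)
  have "\<exists>!\<sigma>. \<sigma> \<in> fin_supp \<and> (conj_by \<sigma> H = reps (at_left 0) \<or> conj_by \<sigma> H = reps (at_right 0))"
    if "is_lift \<Gamma> H" for H
  proof -
    interpret lift \<Gamma> H using that by unfold_locales
    obtain \<sigma> where \<sigma>: "\<sigma> \<in> fin_supp" "\<And>c. (\<lambda>x. x + c) \<in> conj_by \<sigma> H"
      using ex_conj_rotations by blast
    \<comment> \<open>Existence comes from the conjugated lift, which contains the rotations;
      uniqueness comes from \<open>conj_unique\<close> for \<open>H\<close> itself.\<close>
    interpret conj: rotation_lift \<Gamma> "conj_by \<sigma> H"
      using is_lift_conj_by[OF \<sigma>(1) that] \<sigma>(2) by unfold_locales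
    show ?thesis
      using \<sigma>(1) conj.eq_one_sided_reps conj_unique side_left side_right
      by (intro ex1I[of _ \<sigma>]) blast+
  qed
  then show ?thesis
    using is_lift_reps[OF side_left] is_lift_reps[OF side_right] left_reps_neq_right_reps
    by (simp add: left_reps_eq right_reps_eq)
qed

end
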